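(* Let $n\ge 3$ and let $W_n=K_1+C_n$ be the wheel, i.e. the join of a single vertex with the cycle graph $C_n$ on $n$ vertices. Fix any total ordering of $E(W_n)$ and any field $\Bbbk$. Then $$h_{W_n}(z)=(1+z)^n-z^{n-1}-z^n,$$ $$\mathrm{Hilb}(\Bbbk[\mathrm{BC}(W_n)];z)=\frac{(1+z)^n-z^{n-1}-z^n}{(1-z)^n}.$$
   Context: For a finite connected loopless graph $G$ with a fixed total order on $E(G)$, a broken circuit is a set $C\setminus\{\max C\}$, where $C$ is the edge set of a cycle of $G$ and $\max C$ is its largest edge. The broken-circuit complex $\mathrm{BC}(G)$ is the simplicial complex on $E(G)$ whose faces are the edge sets containing no broken circuit. Its Stanley--Reisner ring is $\Bbbk[\mathrm{BC}(G)]=\Bbbk[x_e:e\in E(G)]/I_{\mathrm{BC}(G)}$, with $I_{\mathrm{BC}(G)}$ generated by the monomials $\prod_{e\in C\setminus\{\max C\}}x_e$ over all cycles $C$ of $G$; it is graded by $\deg x_e=1$, and $\mathrm{Hilb}$ denotes its Hilbert series. With $r=|V(G)|-1$ and $b_i$ the number of faces of $\mathrm{BC}(G)$ having exactly $i$ elements, the $h$-polynomial of $\mathrm{BC}(G)$ is $h_G(z)=\sum_{i=0}^{r}b_i z^i(1-z)^{r-i}$. *)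

theory Defs
  imports
    "HOL-Library.Poly_Mapping"
    "HOL-Computational_Algebra.Polynomial"
    "HOL-Computational_Algebra.Formal_Power_Series"
    "HOL-Algebra.QuotRing"
    "HOL-Algebra.Embedded_Algebras"
begin

section \<open>Graphs\<close>

text \<open>Undirected graphs, parallel edges allowed; \<open>ends G e\<close> is the set of endpoints of the edge
  \<open>e\<close>, which has two elements unless \<open>e\<close> is a loop.\<close>

record ('v, 'e) ugraph =
  verts :: "'v set"
  edges :: "'e set"
  ends :: "'e \<Rightarrow> 'v set"

definition simple_ugraph :: "'v set \<Rightarrow> 'v set set \<Rightarrow> ('v, 'v set) ugraph" where
  "simple_ugraph V E = \<lparr>verts = V, edges = E, ends = (\<lambda>e. e)\<rparr>"

definition single_vertex :: "(unit, unit set) ugraph" where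
  "single_vertex = simple_ugraph {()} {}"

text \<open>This is the cycle graph on \<open>n\<close> vertices only for \<open>n \<ge> 3\<close>.\<close>

definition cycle_graph :: "nat \<Rightarrow> (nat, nat set) ugraph" where
  "cycle_graph n = simple_ugraph {..<n} {{i, (i + 1) mod n} | i. i < n}"

text \<open>Join of two simple graphs.\<close>

definition ugraph_join ::
    "('v, 'e) ugraph \<Rightarrow> ('w, 'f) ugraph \<Rightarrow> ('v + 'w, ('v + 'w) set) ugraph" where
  "ugraph_join G H = simple_ugraph (verts G <+> verts H)
     ({Inl ` ends G e | e. e \<in> edges G} \<union> {Inr ` ends H e | e. e \<in> edges H} \<union>
      {{Inl v, Inr w} | v w. v \<in> verts G \<and> w \<in> verts H})"

definition wheel :: "nat \<Rightarrow> (unit + nat, (unit + nat) set) ugraph" where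
  "wheel n = ugraph_join single_vertex (cycle_graph n)"

text \<open>\<open>C\<close> is the edge set of a cycle \<open>v\<^sub>0, e\<^sub>0, v\<^sub>1, e\<^sub>1, \<dots>, v\<^sub>0\<close> with pairwise distinct vertices
  and pairwise distinct edges. Cycles of length one are exactly the loops, and cycles of length two
  are exactly the pairs of parallel edges.\<close>

definition is_cycle :: "('v, 'e) ugraph \<Rightarrow> 'e set \<Rightarrow> bool" where
  "is_cycle G C \<longleftrightarrow> (\<exists>vs es. es \<noteq> [] \<and> length vs = length es \<and> distinct vs \<and> distinct es \<and>
     set vs \<subseteq> verts G \<and> set es \<subseteq> edges G \<and>
     (\<forall>i < length es. ends G (es ! i) = {vs ! i, vs ! ((i + 1) mod length vs)}) \<and>
     C = set es)"


section \<open>The broken-circuit complex\<close>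

text \<open>The total order on the edges is given as a reflexive relation \<open>r\<close> with
  \<open>linear_order_on (edges G) r\<close>, where \<open>(e, f) \<in> r\<close> means \<open>e \<le> f\<close>.\<close>

definition broken_circuits :: "('v, 'e) ugraph \<Rightarrow> 'e rel \<Rightarrow> 'e set set" where
  "broken_circuits G r = {C - {m} | C m. is_cycle G C \<and> m \<in> C \<and> (\<forall>e\<in>C. (e, m) \<in> r)}"

definition bc_complex :: "('v, 'e) ugraph \<Rightarrow> 'e rel \<Rightarrow> 'e set set" where
  "bc_complex G r = {F. F \<subseteq> edges G \<and> (\<forall>B\<in>broken_circuits G r. \<not> B \<subseteq> F)}"

definition h_polynomial :: "('v, 'e) ugraph \<Rightarrow> 'e rel \<Rightarrow> int poly" where
  "h_polynomial G r = (let d = card (verts G) - 1 in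
     \<Sum>i = 0..d. of_nat (card {F \<in> bc_complex G r. card F = i}) * [:0, 1:] ^ i * [:1, -1:] ^ (d - i))"


section \<open>The Stanley--Reisner ring and its Hilbert series\<close>

text \<open>Multivariate polynomials are finitely supported functions from monomials (finitely supported
  exponent functions) to coefficients.\<close>

type_synonym ('e, 'k) mvpoly = "('e \<Rightarrow>\<^sub>0 nat) \<Rightarrow>\<^sub>0 'k"

definition mvar :: "'e \<Rightarrow> ('e, 'k::comm_ring_1) mvpoly" where
  "mvar e = Poly_Mapping.single (Poly_Mapping.single e 1) 1"

definition mconst :: "'k::comm_ring_1 \<Rightarrow> ('e, 'k) mvpoly" where
  "mconst c = Poly_Mapping.single 0 c"

definition mdeg :: "('e \<Rightarrow>\<^sub>0 nat) \<Rightarrow> nat" where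
  "mdeg m = (\<Sum>e\<in>Poly_Mapping.keys m. Poly_Mapping.lookup m e)"

definition mvpoly_ring :: "'e set \<Rightarrow> ('e, 'k::comm_ring_1) mvpoly ring" where
  "mvpoly_ring E = \<lparr>carrier = {p. \<forall>m\<in>Poly_Mapping.keys p. Poly_Mapping.keys m \<subseteq> E},
     mult = (*), one = 1, zero = 0, add = (+)\<rparr>"

definition bc_ideal :: "('v, 'e) ugraph \<Rightarrow> 'e rel \<Rightarrow> ('e, 'k::field) mvpoly set" where
  "bc_ideal G r = Idl\<^bsub>mvpoly_ring (edges G)\<^esub> {\<Prod>e\<in>B. mvar e | B. B \<in> broken_circuits G r}"

definition bc_ring :: "('v, 'e) ugraph \<Rightarrow> 'e rel \<Rightarrow> ('e, 'k::field) mvpoly set ring" where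
  "bc_ring G r = mvpoly_ring (edges G) Quot bc_ideal G r"

text \<open>The image of the field of coefficients in the quotient ring.\<close>

definition bc_scalars :: "('v, 'e) ugraph \<Rightarrow> 'e rel \<Rightarrow> ('e, 'k::field) mvpoly set set" where
  "bc_scalars G r = {bc_ideal G r +>\<^bsub>mvpoly_ring (edges G)\<^esub> mconst c | c. True}"

text \<open>The component of degree \<open>d\<close>: the residue classes of the homogeneous polynomials of degree
  \<open>d\<close> (including the zero polynomial).\<close>

definition bc_component :: "('v, 'e) ugraph \<Rightarrow> 'e rel \<Rightarrow> nat \<Rightarrow> ('e, 'k::field) mvpoly set set" where
  "bc_component G r d = {bc_ideal G r +>\<^bsub>mvpoly_ring (edges G)\<^esub> p | p.
     p \<in> carrier (mvpoly_ring (edges G)) \<and> (\<forall>m\<in>Poly_Mapping.keys p. mdeg m = d)}"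

definition hilbert_series :: "('a, 'b) ring_scheme \<Rightarrow> 'a set \<Rightarrow> (nat \<Rightarrow> 'a set) \<Rightarrow> rat fps" where
  "hilbert_series R K A = Abs_fps (\<lambda>d. of_nat (THE n. ring.dimension R n K (A d)))"

definition bc_hilbert_series ::
    "'k::field itself \<Rightarrow> ('v, 'e) ugraph \<Rightarrow> 'e rel \<Rightarrow> rat fps" where
  "bc_hilbert_series _ G r =
     hilbert_series (bc_ring G r :: ('e, 'k) mvpoly set ring) (bc_scalars G r) (bc_component G r)"

end

theory Submission
  imports Defs "HOL-Number_Theory.Cong"
begin

text \<open>By Whitney's theorem the chromatic polynomial of a connected graph \<open>G\<close> with \<open>b\<^sub>i\<close> faces of size
  \<open>i\<close> in its broken-circuit complex is \<open>\<Sum>\<^sub>i (-1)\<^sup>i b\<^sub>i k\<^bsup>|V|-i\<^esup>\<close>, whatever the order of the edges. A proper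
  \<open>k\<close>-colouring of the wheel is a colour for the hub and a closed walk of length \<open>n\<close> in the complete
  graph on the other \<open>k - 1\<close> colours, which gives \<open>k ((k-2)\<^sup>n + (-1)\<^sup>n (k-2))\<close>. Comparing coefficients
  determines the \<open>b\<^sub>i\<close>, and the binomial theorem evaluates the \<open>h\<close>-polynomial.

  The generating ideal is a monomial ideal, so the monomials whose support is a face form a basis of
  the Stanley--Reisner ring. A face \<open>F\<close> is the support of monomials with generating function
  \<open>(z/(1-z))\<^bsup>|F|\<^esup>\<close>, so the Hilbert series is the \<open>h\<close>-polynomial divided by \<open>(1-z)\<^sup>n\<close>.\<close>


section \<open>Whitney's broken-circuit theorem\<close>

text \<open>Comparing all pairs of endpoints makes every loop monochromatic, so a graph with a loop
  has no proper colouring.\<close>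

definition monochromatic :: "('v, 'e) ugraph \<Rightarrow> ('v \<Rightarrow> 'c) \<Rightarrow> 'e \<Rightarrow> bool" where
  "monochromatic G f e \<longleftrightarrow> (\<forall>u\<in>ends G e. \<forall>v\<in>ends G e. f u = f v)"

text \<open>For a finite graph and \<open>F\<close> among its edges, their number is
  \<open>k\<close> to the power of the number of connected components of the spanning subgraph with
  edge set \<open>F\<close>.\<close>

definition constant_colourings :: "('v, 'e) ugraph \<Rightarrow> nat \<Rightarrow> 'e set \<Rightarrow> ('v \<Rightarrow> nat) set" where
  "constant_colourings G k F =
     {f \<in> verts G \<rightarrow>\<^sub>E {..<k}. \<forall>e\<in>F. monochromatic G f e}"

definition proper_colourings :: "('v, 'e) ugraph \<Rightarrow> nat \<Rightarrow> ('v \<Rightarrow> nat) set" where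
  "proper_colourings G k =
     {f \<in> verts G \<rightarrow>\<^sub>E {..<k}. \<forall>e\<in>edges G. \<not> monochromatic G f e}"

definition adjacent :: "('v, 'e) ugraph \<Rightarrow> 'e set \<Rightarrow> 'v \<Rightarrow> 'v \<Rightarrow> bool" where
  "adjacent G F u v \<longleftrightarrow> (\<exists>e\<in>F. ends G e = {u, v})"

definition acyclic_edges :: "('v, 'e) ugraph \<Rightarrow> 'e set \<Rightarrow> bool" where
  "acyclic_edges G F \<longleftrightarrow> (\<forall>C. is_cycle G C \<longrightarrow> \<not> C \<subseteq> F)"

lemma monochromatic_pair:
  "ends G e = {u, v} \<Longrightarrow> monochromatic G f e \<longleftrightarrow> f u = f v"
  by (auto simp: monochromatic_def)

section \<open>Paths, forests and counts of edge-constant colourings\<close>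

locale finite_ugraph =
  fixes G :: "('v, 'e) ugraph" (structure)
  assumes finite_verts: "finite (verts G)"
    and finite_edges: "finite (edges G)"
    and ends_edge: "e \<in> edges G \<Longrightarrow> \<exists>u\<in>verts G. \<exists>v\<in>verts G. ends G e = {u, v}"
begin

lemma finite_constant_colourings: "finite (constant_colourings G k F)"
  unfolding constant_colourings_def using finite_verts by (simp add: finite_PiE)

text \<open>Induction along the walk keeps the path simple: a new vertex already on the path cuts it
  back to that vertex, any other vertex is appended.\<close>

lemma simple_path:
  assumes "F \<subseteq> edges G" "u \<in> verts G" "(adjacent G F)\<^sup>*\<^sup>* u v"
  shows "\<exists>vs es. length vs = Suc (length es) \<and> distinct vs \<and> set vs \<subseteq> verts G \<and> set es \<subseteq> F \<and>
    vs ! 0 = u \<and> vs ! length es = v \<and>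
    (\<forall>i < length es. ends G (es ! i) = {vs ! i, vs ! Suc i})"
  using assms(3)
proof (induction rule: rtranclp_induct)
  case base
  then show ?case
    by (intro exI[of _ "[u]"] exI[of _ "[]"]) (use assms in auto)
next
  case (step v w)
  then obtain vs es where p: "length vs = Suc (length es)" "distinct vs" "set vs \<subseteq> verts G"
    "set es \<subseteq> F" "vs ! 0 = u" "vs ! length es = v"
    "\<And>i. i < length es \<Longrightarrow> ends G (es ! i) = {vs ! i, vs ! Suc i}" by blast
  obtain e where e: "e \<in> F" "ends G e = {v, w}" using step(2) by (auto simp: adjacent_def)
  show ?case
  proof (cases "w \<in> set vs")
    case True
    then obtain j where j: "j \<le> length es" "vs ! j = w"
      using p(1) by (metis in_set_conv_nth less_Suc_eq_le)
    then show ?thesis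
      by (intro exI[of _ "take (Suc j) vs"] exI[of _ "take j es"])
        (use p in \<open>auto dest: in_set_takeD simp: min_def\<close>)
  next
    case False
    have "w \<in> verts G" using ends_edge[of e] e assms(1) by (auto simp: doubleton_eq_iff)
    then show ?thesis
      by (intro exI[of _ "vs @ [w]"] exI[of _ "es @ [e]"])
        (use p e False in \<open>auto simp: nth_append less_Suc_eq\<close>)
  qed
qed

text \<open>A simple path in \<open>F\<close> from \<open>u\<close> to \<open>v\<close>, closed up
  by \<open>e\<close>, is a cycle.\<close>

lemma cycle_of_connected_ends:
  assumes "F \<subseteq> edges G" "e \<in> edges G" "e \<notin> F" "ends G e = {u, v}" "(adjacent G F)\<^sup>*\<^sup>* u v"
  shows "\<not> acyclic_edges G (insert e F)"
proof -
  have "u \<in> verts G" using ends_edge[of e] assms(2,4) by (auto simp: doubleton_eq_iff)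
  then obtain vs es where p: "length vs = Suc (length es)" "distinct vs" "set vs \<subseteq> verts G"
    "set es \<subseteq> F" "vs ! 0 = u" "vs ! length es = v"
    "\<And>i. i < length es \<Longrightarrow> ends G (es ! i) = {vs ! i, vs ! Suc i}"
    using simple_path[OF assms(1) _ assms(5)] by blast
  \<comment> \<open>Equal edges have equal pairs of end vertices, and since the vertices of the path
    are distinct, the two positions coincide.\<close>
  have "distinct es"
    unfolding distinct_conv_nth
  proof (intro allI impI notI)
    fix i j assume ij: "i < length es" "j < length es" "i \<noteq> j" "es ! i = es ! j"
    then have "{vs ! i, vs ! Suc i} = {vs ! j, vs ! Suc j}" using p(7) by metis
    then show False
      using ij p(1,2) by (auto simp: doubleton_eq_iff nth_eq_iff_index_eq)
  qed
  \<comment> \<open>The edge \<open>e\<close> sits at position \<open>length es\<close>, where the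
    index modulo \<open>length vs\<close> wraps around and leads from \<open>v\<close> back to
    \<open>u\<close>.\<close>
  moreover have "ends G ((es @ [e]) ! i) = {vs ! i, vs ! ((i + 1) mod length vs)}"
    if "i < length (es @ [e])" for i
  proof (cases "i < length es")
    case True
    then show ?thesis using p(1,7) by (simp add: nth_append)
  next
    case False
    then have "i = length es" using that by simp
    then show ?thesis using p assms(4) by (simp add: insert_commute)
  qed
  ultimately have "is_cycle G (insert e (set es))"
    unfolding is_cycle_def
    by (intro exI[of _ vs] exI[of _ "es @ [e]"])
      (use p assms in auto)
  then show ?thesis using p(4) unfolding acyclic_edges_def by blast
qed

text \<open>An edge that closes no cycle joins two different components of \<open>F\<close>, whose
  colours can be shifted independently. A colouring constant on \<open>F\<close> thus corresponds to
  one that also agrees across \<open>e\<close>, together with a shift \<open>j < k\<close>.\<close>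

lemma card_constant_colourings_insert:
  assumes "F \<subseteq> edges G" "e \<in> edges G" "e \<notin> F" "acyclic_edges G (insert e F)"
  shows "card (constant_colourings G k F) = card (constant_colourings G k (insert e F)) * k"
proof -
  obtain u v where uv: "u \<in> verts G" "v \<in> verts G" "ends G e = {u, v}"
    using ends_edge assms(2) by blast
  have ins: "f \<in> constant_colourings G k (insert e F) \<longleftrightarrow>
      f \<in> constant_colourings G k F \<and> f u = f v" for f
    by (auto simp: constant_colourings_def monochromatic_pair[OF uv(3)])
  define S where "S = {w. (adjacent G F)\<^sup>*\<^sup>* u w}"
  have uS: "u \<in> S" and vS: "v \<notin> S"
    using cycle_of_connected_ends[OF assms(1-3) uv(3)] assms(4) by (auto simp: S_def)
  \<comment> \<open>No edge of \<open>F\<close> leaves \<open>S\<close>, so its two ends are shifted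
    together or not at all and it stays monochromatic.\<close>
  have S_edge: "x \<in> S \<longleftrightarrow> y \<in> S" if "e' \<in> F" "ends G e' = {x, y}" for e' x y
  proof -
    have "adjacent G F x y" "adjacent G F y x"
      using that by (auto simp: adjacent_def insert_commute)
    then show ?thesis by (auto simp: S_def intro: rtranclp.rtrancl_into_rtrancl)
  qed
  \<comment> \<open>Adding \<open>j\<close> modulo \<open>k\<close> to the colours on the \<open>F\<close>-component \<open>S\<close> of \<open>u\<close>, which misses \<open>v\<close>,
    makes all differences between the colours of \<open>u\<close> and \<open>v\<close> equally frequent.\<close>
  define shift where
    "shift j f = restrict (\<lambda>w. if w \<in> S then (f w + j) mod k else f w) (verts G)"
    for j and f :: "'v \<Rightarrow> nat"
  have shift_mono: "shift j f \<in> constant_colourings G k F"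
    if "f \<in> constant_colourings G k F" for j f
  proof -
    have f: "f \<in> verts G \<rightarrow>\<^sub>E {..<k}" "\<And>e. e \<in> F \<Longrightarrow> monochromatic G f e"
      using that by (auto simp: constant_colourings_def)
    have "shift j f w < k" if "w \<in> verts G" for w
    proof -
      have "f w < k" using PiE_mem[OF f(1) that] by simp
      then show ?thesis using that by (auto simp: shift_def)
    qed
    moreover have "monochromatic G (shift j f) e'" if e': "e' \<in> F" for e'
    proof -
      obtain x y where xy: "x \<in> verts G" "y \<in> verts G" "ends G e' = {x, y}"
        using ends_edge e' assms(1) by blast
      then show ?thesis
        using f(2)[OF e'] S_edge[OF e' xy(3)] by (simp add: monochromatic_pair[OF xy(3)] shift_def)
    qed
    ultimately show ?thesis
      by (auto simp: constant_colourings_def PiE_iff shift_def extensional_def)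
  qed
  have "bij_betw (\<lambda>(f, j). shift j f) (constant_colourings G k (insert e F) \<times> {..<k})
      (constant_colourings G k F)"
    unfolding bij_betw_def
  proof (intro conjI equalityI subsetI)
    show "inj_on (\<lambda>(f, j). shift j f) (constant_colourings G k (insert e F) \<times> {..<k})"
    proof (intro inj_onI; clarsimp)
      fix f j f' j'
      assume f: "f \<in> constant_colourings G k (insert e F)" "f' \<in> constant_colourings G k (insert e F)"
        and j: "j < k" "j' < k" and eq: "shift j f = shift j' f'"
      have uv': "f u = f v" "f' u = f' v" using f ins by auto
      have E: "f \<in> verts G \<rightarrow>\<^sub>E {..<k}" "f' \<in> verts G \<rightarrow>\<^sub>E {..<k}"
        using f by (auto simp: constant_colourings_def)
      have pt: "shift j f w = shift j' f' w" for w using eq by simp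
      \<comment> \<open>The colour of \<open>v\<close> is never shifted; comparing the colours of
        \<open>u\<close> afterwards recovers the shift.\<close>
      have "f v = f' v" using pt[of v] uv vS by (simp add: shift_def)
      then have "(f u + j) mod k = (f u + j') mod k"
        using pt[of u] uv uS uv' by (simp add: shift_def)
      then have "[j = j'] (mod k)" by (metis cong_add_lcancel_nat cong_def)
      then have jj: "j = j'" using j by (simp add: cong_less_modulus_unique_nat)
      have "f w = f' w" if "w \<in> verts G" for w
      proof (cases "w \<in> S")
        case True
        then have "[f w = f' w] (mod k)"
          using pt[of w] that jj cong_add_rcancel_nat[of "f w" j "f' w" k]
          by (simp add: shift_def cong_def)
        then show ?thesis
          using PiE_mem[OF E(1) that] PiE_mem[OF E(2) that]
          by (simp add: cong_less_modulus_unique_nat)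
      next
        case False
        then show ?thesis using pt[of w] that by (simp add: shift_def)
    qed
    then show "f = f' \<and> j = j'" using jj PiE_ext[OF E] by blast
    qed
  next
    fix g assume "g \<in> (\<lambda>(f, j). shift j f) ` (constant_colourings G k (insert e F) \<times> {..<k})"
    then obtain f j where "g = shift j f" "f \<in> constant_colourings G k (insert e F)" by auto
    then show "g \<in> constant_colourings G k F"
      using shift_mono[of f j] ins by auto
  next
    fix f assume f: "f \<in> constant_colourings G k F"
    then have E: "f \<in> verts G \<rightarrow>\<^sub>E {..<k}" by (auto simp: constant_colourings_def)
    have k: "f u < k" "f v < k" using PiE_mem[OF E] uv by auto
    \<comment> \<open>\<open>j\<close> is the difference of the colours of \<open>u\<close> and
      \<open>v\<close> modulo \<open>k\<close>, written with \<open>k - f v\<close> to avoid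
      truncated subtraction. Shifting by \<open>k - j\<close> gives \<open>u\<close> the colour of
      \<open>v\<close>, and a further shift by \<open>j\<close> undoes this.\<close>
    define j where "j = (f u + (k - f v)) mod k"
    define f' where "f' = shift (k - j) f"
    have jk: "j < k" using k by (simp add: j_def)
    have "[f u + (k - j) + j = f v + j] (mod k)"
    proof -
      have "[f v + j = f v + (f u + (k - f v))] (mod k)"
        by (simp add: j_def cong_def mod_add_right_eq)
      also have "f v + (f u + (k - f v)) = f u + (k - j) + j" using k jk by simp
      finally show ?thesis by (rule cong_sym)
    qed
    then have "(f u + (k - j)) mod k = f v"
      using k cong_add_rcancel_nat[of "f u + (k - j)" j "f v" k] by (simp add: cong_def)
    then have "f' u = f' v" using uv uS vS by (simp add: f'_def shift_def)
    then have f': "f' \<in> constant_colourings G k (insert e F)"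
      using shift_mono[OF f, of "k - j"] ins by (simp add: f'_def)
    have "shift j f' w = f w" for w
    proof (cases "w \<in> verts G")
      case True
      then have "f w < k" using PiE_mem[OF E] by blast
      moreover have "((f w + (k - j)) mod k + j) mod k = (f w + k) mod k"
        using jk by (simp only: mod_add_left_eq) simp
      ultimately show ?thesis using True by (simp add: shift_def f'_def)
    next
      case False
      then show ?thesis using PiE_arb[OF E] by (simp add: shift_def)
    qed
    then have "f = shift j f'" by auto
    then show "f \<in> (\<lambda>(f, j). shift j f) ` (constant_colourings G k (insert e F) \<times> {..<k})"
      using f' jk by force
  qed
  then show ?thesis by (simp add: bij_betw_same_card[symmetric] card_cartesian_product)
qed

text \<open>Each edge of a forest divides the number of colourings by \<open>k\<close>, starting
  from all \<open>k ^ card (verts G)\<close> of them.\<close>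

lemma card_constant_colourings:
  assumes "F \<subseteq> edges G" "acyclic_edges G F"
  shows "card (constant_colourings G k F) * k ^ card F = k ^ card (verts G)"
proof -
  have "finite F" using assms(1) finite_edges finite_subset by blast
  then show ?thesis using assms
  proof (induction F)
    case empty
    then show ?case using finite_verts by (simp add: constant_colourings_def card_PiE)
  next
    case (insert e F)
    then have "acyclic_edges G F" by (auto simp: acyclic_edges_def)
    then show ?case
      using insert card_constant_colourings_insert[of F e k] by (simp add: mult.assoc)
  qed
qed

text \<open>Count with two colours: the two constant colourings always qualify, so
  \<open>2 * 2 ^ card F\<close> is at most \<open>2 ^ card (verts G)\<close>.\<close>

lemma card_acyclic_less:
  assumes "F \<subseteq> edges G" "acyclic_edges G F" "verts G \<noteq> {}"
  shows "card F < card (verts G)"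
proof -
  have sub: "(\<lambda>c. restrict (\<lambda>_. c) (verts G)) ` {..<2} \<subseteq> constant_colourings G 2 F"
    (is "?h ` _ \<subseteq> _")
  proof clarify
    fix c :: nat assume "c < 2"
    moreover have "monochromatic G (?h c) e" if e: "e \<in> F" for e
    proof -
      obtain u v where "u \<in> verts G" "v \<in> verts G" "ends G e = {u, v}"
        using ends_edge e assms(1) by blast
      then show ?thesis by (simp add: monochromatic_pair)
    qed
    ultimately show "?h c \<in> constant_colourings G 2 F"
      by (auto simp: constant_colourings_def)
  qed
  have "inj_on ?h {..<2}"
    using assms(3) by (intro inj_onI) (metis all_not_in_conv restrict_apply')
  then have "2 \<le> card (constant_colourings G 2 F)"
    using card_mono[OF finite_constant_colourings sub] by (simp add: card_image)
  then have "2 * 2 ^ card F \<le> (2::nat) ^ card (verts G)"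
    using card_constant_colourings[OF assms(1,2), of 2] by (metis mult_le_mono1)
  then have "(2::nat) ^ Suc (card F) \<le> 2 ^ card (verts G)" by simp
  then show ?thesis by (simp only: power_increasing_iff)
qed

text \<open>Inclusion-exclusion: for each colouring, the product over all edges of one minus the
  indicator of being monochromatic is expanded into a sum over edge sets.\<close>

lemma sum_constant_colourings:
  "(\<Sum>F\<in>Pow (edges G). (-1) ^ card F * int (card (constant_colourings G k F))) =
     int (card (proper_colourings G k))"
proof -
  define U where "U = (verts G \<rightarrow>\<^sub>E {..<k})"
  have finU: "finite U" using finite_verts by (simp add: U_def finite_PiE)
  have fin: "finite F" if "F \<in> Pow (edges G)" for F
    using that finite_edges finite_subset by auto
  have "(-1) ^ card F * int (card (constant_colourings G k F)) =
      (\<Sum>f\<in>U. \<Prod>e\<in>F. - of_bool (monochromatic G f e))" if "F \<in> Pow (edges G)" for F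
  proof -
    have "int (card (constant_colourings G k F)) = (\<Sum>f\<in>U. of_bool (\<forall>e\<in>F. monochromatic G f e))"
      using finU by (simp add: constant_colourings_def U_def of_bool_def sum.If_cases Int_def)
    also have "\<dots> = (\<Sum>f\<in>U. \<Prod>e\<in>F. of_bool (monochromatic G f e))"
      using fin[OF that] by (intro sum.cong) auto
    finally show ?thesis
      by (simp add: sum_distrib_left prod_uminus)
  qed
  then have "(\<Sum>F\<in>Pow (edges G). (-1) ^ card F * int (card (constant_colourings G k F))) =
      (\<Sum>f\<in>U. \<Sum>F\<in>Pow (edges G). \<Prod>e\<in>F. - of_bool (monochromatic G f e))"
    by (simp add: sum.swap[of _ U])
  also have "\<dots> = (\<Sum>f\<in>U. \<Prod>e\<in>edges G. - of_bool (monochromatic G f e) + 1)"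
    by (subst prod_add[OF finite_edges]) simp
  also have "\<dots> = (\<Sum>f\<in>U. of_bool (\<forall>e\<in>edges G. \<not> monochromatic G f e))"
    using finite_edges by (intro sum.cong refl) (auto simp: of_bool_def intro!: prod.neutral)
  also have "\<dots> = int (card (proper_colourings G k))"
    using finU by (simp add: proper_colourings_def U_def of_bool_def sum.If_cases Int_def)
  finally show ?thesis .
qed

end

section \<open>Extremal edges and the cancellation of non-faces\<close>

lemma linear_order_on_finite_min:
  assumes "linear_order_on A r" "finite M" "M \<noteq> {}" "M \<subseteq> A"
  shows "\<exists>m\<in>M. \<forall>x\<in>M. (m, x) \<in> r"
  using assms(2-)
proof (induction M rule: finite_ne_induct)
  case (singleton x)
  then show ?case
    using assms(1) by (auto simp: order_on_defs refl_on_def)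
next
  case (insert x M)
  then obtain m where m: "m \<in> M" "\<forall>y\<in>M. (m, y) \<in> r" by auto
  have "x = m \<or> (m, x) \<in> r \<or> (x, m) \<in> r" "(x, x) \<in> r" "trans r"
    using assms(1) insert m by (auto simp: order_on_defs refl_on_def total_on_def)
  then have "(\<forall>y\<in>insert x M. (m, y) \<in> r) \<or> (\<forall>y\<in>insert x M. (x, y) \<in> r)"
    using m by (auto dest: transD)
  then show ?case using m(1) by blast
qed

lemma linear_order_on_finite_max:
  assumes "linear_order_on A r" "finite M" "M \<noteq> {}" "M \<subseteq> A"
  shows "\<exists>m\<in>M. \<forall>x\<in>M. (x, m) \<in> r"
  using linear_order_on_finite_min[of A "r\<inverse>" M] assms by simp

lemma is_cycleD:
  assumes "is_cycle G C"
  shows "C \<subseteq> edges G" "C \<noteq> {}" "finite C"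
  using assms by (auto simp: is_cycle_def)

text \<open>The other edges of the cycle form a path between the ends of \<open>m\<close>, along
  which the colour does not change.\<close>

lemma monochromatic_cycle:
  assumes "is_cycle G C" "m \<in> C" "\<forall>e\<in>C - {m}. monochromatic G f e"
  shows "monochromatic G f m"
proof -
  obtain vs es where c: "length vs = length es" "distinct es"
    "\<And>i. i < length es \<Longrightarrow> ends G (es ! i) = {vs ! i, vs ! ((i + 1) mod length es)}" "C = set es"
    using assms(1) unfolding is_cycle_def by metis
  define L where "L = length es"
  obtain j where j: "j < L" "es ! j = m" using assms(2) c(4) by (metis L_def in_set_conv_nth)
  \<comment> \<open>The walk starts at the end of \<open>m\<close> with index \<open>j + 1\<close>;
    with fewer than \<open>L\<close> steps it does not reach position \<open>j\<close> of the edge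
    list, so \<open>m\<close> itself is never traversed.\<close>
  have "f (vs ! ((j + 1 + t) mod L)) = f (vs ! ((j + 1) mod L))" if "t < L" for t
    using that
  proof (induction t)
    case (Suc t)
    define i where "i = (j + 1 + t) mod L"
    have i: "i < L" using j by (simp add: i_def)
    have "i \<noteq> j"
    proof
      assume "i = j"
      then have "(j + 1 + t) mod L = j mod L" using j by (simp add: i_def)
      then have "L dvd (j + 1 + t) - j" by (metis le_add1 add.assoc mod_eq_dvd_iff_nat)
      then show False using Suc.prems by (auto dest: dvd_imp_le)
    qed
    then have "es ! i \<in> C - {m}"
      using c(2,4) i j by (auto simp: L_def nth_eq_iff_index_eq)
    then have "f (vs ! i) = f (vs ! ((i + 1) mod L))"
      using assms(3) c(3)[of i] i by (auto simp: monochromatic_def L_def)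
    moreover have "(i + 1) mod L = (j + 1 + Suc t) mod L" by (simp add: i_def mod_Suc_eq)
    ultimately show ?case using Suc by (simp add: i_def)
  qed simp
  \<comment> \<open>After \<open>L - 1\<close> steps the index is \<open>j\<close> again, the other
    end of \<open>m\<close>.\<close>
  from this[of "L - 1"] have "f (vs ! j) = f (vs ! ((j + 1) mod L))" using j by simp
  then show ?thesis using c(3)[of j] j by (auto simp: monochromatic_def L_def)
qed

text \<open>A cycle inside \<open>F\<close> would bring its own broken circuit into
  \<open>F\<close>.\<close>

lemma bc_complex_acyclic:
  assumes "linear_order_on (edges G) r" "F \<in> bc_complex G r"
  shows "acyclic_edges G F"
  unfolding acyclic_edges_def
proof (intro allI impI notI)
  fix C assume C: "is_cycle G C" "C \<subseteq> F"
  then obtain m where "m \<in> C" "\<forall>x\<in>C. (x, m) \<in> r"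
    using linear_order_on_finite_max[OF assms(1)] is_cycleD by metis
  then have "C - {m} \<in> broken_circuits G r" using C by (auto simp: broken_circuits_def)
  then show False using assms(2) C(2) by (auto simp: bc_complex_def)
qed

context finite_ugraph begin

text \<open>Toggling the smallest edge \<open>m\<close> such that \<open>C - {m} \<subseteq> F\<close> for some cycle \<open>C\<close> with largest
  edge \<open>m\<close> is a sign-reversing involution on the sets \<open>F\<close> outside the broken-circuit complex; minimality
  keeps every other candidate cycle away from the toggled edge.\<close>

lemma sum_non_faces:
  assumes "linear_order_on (edges G) r"
  shows "(\<Sum>F\<in>Pow (edges G) - bc_complex G r.
    (-1) ^ card F * int (card (constant_colourings G k F))) = 0" (is "sum ?g ?N = 0")
proof -
  define M where
    "M F = {m. \<exists>C. is_cycle G C \<and> m \<in> C \<and> (\<forall>e\<in>C. (e, m) \<in> r) \<and> C - {m} \<subseteq> F}" for F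
  define \<mu> where "\<mu> F = (THE m. m \<in> M F \<and> (\<forall>x\<in>M F. (m, x) \<in> r))" for F
  define \<phi> where "\<phi> F = (if \<mu> F \<in> F then F - {\<mu> F} else insert (\<mu> F) F)" for F
  have anti: "antisym r" using assms by (auto simp: order_on_defs)
  have M_sub: "M F \<subseteq> edges G" for F using is_cycleD(1) by (auto simp: M_def)
  have N_iff: "F \<in> ?N \<longleftrightarrow> F \<subseteq> edges G \<and> M F \<noteq> {}" for F
    by (auto simp: bc_complex_def broken_circuits_def M_def)
  have \<mu>_eq: "\<mu> F = m" if "m \<in> M F" "\<forall>x\<in>M F. (m, x) \<in> r" for F m
    unfolding \<mu>_def using that anti by (intro the_equality) (auto dest: antisymD)
  have \<mu>: "\<mu> F \<in> M F" "\<forall>x\<in>M F. (\<mu> F, x) \<in> r" if "F \<in> ?N" for F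
  proof -
    have "M F \<noteq> {}" using that unfolding N_iff by simp
    then obtain m where m: "m \<in> M F" "\<forall>x\<in>M F. (m, x) \<in> r"
      using linear_order_on_finite_min[OF assms finite_subset[OF M_sub finite_edges] _ M_sub]
      by blast
    then show "\<mu> F \<in> M F" "\<forall>x\<in>M F. (\<mu> F, x) \<in> r" using \<mu>_eq by blast+
  qed
  have \<phi>: "\<phi> F \<in> ?N \<and> \<phi> (\<phi> F) = F \<and> ?g (\<phi> F) = - ?g F" if F: "F \<in> ?N" for F
  proof -
    define m where "m = \<mu> F"
    obtain C where C: "is_cycle G C" "m \<in> C" "\<forall>e\<in>C. (e, m) \<in> r" "C - {m} \<subseteq> F"
      using \<mu>(1)[OF F] by (auto simp: M_def m_def)
    have mE: "m \<in> edges G" using C is_cycleD(1) by blast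
    have m_in: "m \<in> M (\<phi> F)" using C by (auto simp: M_def \<phi>_def m_def)
    have N': "\<phi> F \<in> ?N"
      using F mE m_in N_iff by (auto simp: \<phi>_def m_def[symmetric])
    \<comment> \<open>\<open>m\<close> is still the least candidate after the toggle. If
      \<open>x\<close> is a candidate with \<open>m\<close> not below it, its cycle \<open>D\<close>
      has \<open>x\<close> as largest edge and so avoids \<open>m\<close>; then
      \<open>D - {x}\<close> already lay in \<open>F\<close>, against the choice of
      \<open>m\<close>.\<close>
    have "(m, x) \<in> r" if x: "x \<in> M (\<phi> F)" for x
    proof (rule ccontr)
      assume mx: "(m, x) \<notin> r"
      obtain D where D: "is_cycle G D" "x \<in> D" "\<forall>e\<in>D. (e, x) \<in> r" "D - {x} \<subseteq> \<phi> F"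
        using x by (auto simp: M_def)
      then have "m \<notin> D" using mx by blast
      then have "D - {x} \<subseteq> F" using D(4) by (auto simp: \<phi>_def m_def split: if_splits)
      then have "x \<in> M F" using D by (auto simp: M_def)
      then show False using \<mu>(2)[OF F] mx by (auto simp: m_def)
    qed
    then have "\<mu> (\<phi> F) = m" using \<mu>_eq m_in by blast
    then have inv: "\<phi> (\<phi> F) = F" unfolding \<phi>_def[of "\<phi> F"] by (auto simp: \<phi>_def m_def)
    have "finite F" using F finite_edges finite_subset by auto
    then have sgn: "(-1::int) ^ card (\<phi> F) = - ((-1) ^ card F)"
    proof (cases "m \<in> F")
      case True
      then have "card F = Suc (card (F - {m}))" using \<open>finite F\<close> by (rule card.remove[rotated])
      then show ?thesis
        using True by (metis \<phi>_def m_def minus_minus mult_minus1 power_Suc)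
    next
      case False
      then show ?thesis using \<open>finite F\<close> by (simp add: \<phi>_def m_def[symmetric])
    qed
    \<comment> \<open>Both \<open>F\<close> and \<open>\<phi> F\<close> contain
      \<open>C - {m}\<close>, which forces \<open>m\<close> to be monochromatic; the toggle leaves
      the set of colourings unchanged and only flips the sign.\<close>
    have "monochromatic G f m" if f: "\<forall>e\<in>C - {m}. monochromatic G f e" for f :: "'v \<Rightarrow> nat"
      using monochromatic_cycle[OF C(1,2)] f by blast
    then have "constant_colourings G k (\<phi> F) = constant_colourings G k F"
      using C(4) unfolding constant_colourings_def \<phi>_def m_def[symmetric] by auto
    then show ?thesis using N' inv sgn by simp
  qed
  have "sum ?g ?N = (\<Sum>F\<in>?N. - ?g F)"
    by (rule sum.reindex_bij_witness[of _ \<phi> \<phi>]) (use \<phi> in auto)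
  then show ?thesis by (simp add: sum_negf)
qed

text \<open>In the inclusion-exclusion sum the non-faces cancel. A face is a forest with fewer edges
  than there are vertices, so its colouring count is the displayed power and the subtraction in the
  exponent is exact.\<close>

theorem whitney_broken_circuit:
  assumes "linear_order_on (edges G) r" "verts G \<noteq> {}" "k > 0"
  shows "(\<Sum>F\<in>bc_complex G r. (-1) ^ card F * int k ^ (card (verts G) - card F)) =
    int (card (proper_colourings G k))"
proof -
  let ?g = "\<lambda>F. (-1) ^ card F * int (card (constant_colourings G k F))"
  have BC: "bc_complex G r \<subseteq> Pow (edges G)" by (auto simp: bc_complex_def)
  have "(-1) ^ card F * int k ^ (card (verts G) - card F) = ?g F" if "F \<in> bc_complex G r" for F
  proof -
    have F: "F \<subseteq> edges G" "acyclic_edges G F"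
      using that BC bc_complex_acyclic[OF assms(1)] by auto
    have "card (constant_colourings G k F) * k ^ card F =
        k ^ (card (verts G) - card F) * k ^ card F"
      using card_constant_colourings[OF F, of k] card_acyclic_less[OF F assms(2)]
      by (simp flip: power_add)
    then show ?thesis using assms(3) by simp
  qed
  then have "(\<Sum>F\<in>bc_complex G r. (-1) ^ card F * int k ^ (card (verts G) - card F)) =
      sum ?g (bc_complex G r)" by (intro sum.cong) auto
  also have "\<dots> = sum ?g (Pow (edges G))"
    using sum.subset_diff[OF BC, of ?g] finite_edges sum_non_faces[OF assms(1), of k] by simp
  finally show ?thesis using sum_constant_colourings by simp
qed

end


section \<open>Face numbers of the wheel\<close>

definition walks :: "nat \<Rightarrow> 'a set \<Rightarrow> 'a list set" where
  "walks m Q = {xs. length xs = m \<and> set xs \<subseteq> Q \<and> successively (\<noteq>) xs}"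

text \<open>The starting vertex is not repeated at the end: the closing step is the condition on
  \<open>last\<close> and \<open>hd\<close>, so there is none of length one.\<close>

definition closed_walks :: "nat \<Rightarrow> 'a set \<Rightarrow> 'a list set" where
  "closed_walks m Q = {xs \<in> walks m Q. last xs \<noteq> hd xs}"

lemma finite_walks: "finite Q \<Longrightarrow> finite (walks m Q)"
  by (rule finite_subset[OF _ finite_lists_length_eq[of Q m]]) (auto simp: walks_def)

lemma card_walks:
  assumes "finite Q"
  shows "int (card (walks (Suc m) Q)) = int (card Q) * (int (card Q) - 1) ^ m"
proof (induction m)
  case 0
  have "walks (Suc 0) Q = (\<lambda>x. [x]) ` Q" by (auto simp: walks_def length_Suc_conv)
  then show ?case by (simp add: card_image inj_on_def)
next
  case (Suc m)
  have "walks (Suc (Suc m)) Q = (\<lambda>(xs, y). y # xs) ` (SIGMA xs:walks (Suc m) Q. Q - {hd xs})"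
    by (force simp: walks_def length_Suc_conv image_iff)
  moreover have "inj_on (\<lambda>(xs, y). y # xs) (SIGMA xs:walks (Suc m) Q. Q - {hd xs})"
    by (auto simp: inj_on_def)
  ultimately have "card (walks (Suc (Suc m)) Q) = (\<Sum>xs\<in>walks (Suc m) Q. card (Q - {hd xs}))"
    using assms finite_walks[OF assms] by (simp add: card_image)
  moreover have "int (card (Q - {hd xs})) = int (card Q) - 1" if "xs \<in> walks (Suc m) Q" for xs
  proof -
    have "hd xs \<in> Q" using that by (auto simp: walks_def length_Suc_conv)
    then have "card Q = Suc (card (Q - {hd xs}))" using assms by (intro card.remove)
    then show ?thesis by simp
  qed
  ultimately show ?case using Suc by simp
qed

text \<open>A walk that is not closed begins with its last vertex, and dropping that first entry
  leaves a closed walk one shorter. Hence consecutive counts of closed walks add up to the number of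
  walks.\<close>

lemma card_closed_walks:
  assumes "finite Q"
  shows "int (card (closed_walks (Suc m) Q)) =
    (int (card Q) - 1) ^ Suc m + (-1) ^ Suc m * (int (card Q) - 1)"
proof (induction m)
  case 0
  have "closed_walks (Suc 0) Q = {}" by (auto simp: closed_walks_def walks_def length_Suc_conv)
  then show ?case by simp
next
  case (Suc m)
  have "walks (Suc (Suc m)) Q =
      closed_walks (Suc (Suc m)) Q \<union> (\<lambda>xs. last xs # xs) ` closed_walks (Suc m) Q"
  proof (intro equalityI subsetI)
    fix ys assume ys: "ys \<in> walks (Suc (Suc m)) Q"
    then obtain y xs where "ys = y # xs" "length xs = Suc m"
      by (auto simp: walks_def length_Suc_conv)
    moreover from this have "xs \<noteq> []" by auto
    ultimately show "ys \<in> closed_walks (Suc (Suc m)) Q \<union> (\<lambda>xs. last xs # xs) ` closed_walks (Suc m) Q"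
      using ys by (auto simp: closed_walks_def walks_def successively_Cons)
  next
    fix ys
    assume "ys \<in> closed_walks (Suc (Suc m)) Q \<union> (\<lambda>xs. last xs # xs) ` closed_walks (Suc m) Q"
    then show "ys \<in> walks (Suc (Suc m)) Q"
    proof
      assume "ys \<in> (\<lambda>xs. last xs # xs) ` closed_walks (Suc m) Q"
      then obtain xs where xs: "ys = last xs # xs" "xs \<in> closed_walks (Suc m) Q" by blast
      then have "xs \<noteq> []" by (auto simp: closed_walks_def walks_def)
      then have "last xs \<in> set xs" by simp
      then show ?thesis
        using xs by (auto simp: closed_walks_def walks_def successively_Cons)
    qed (simp add: closed_walks_def)
  qed
  moreover have "closed_walks (Suc (Suc m)) Q \<inter> (\<lambda>xs. last xs # xs) ` closed_walks (Suc m) Q = {}"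
    by (auto simp: closed_walks_def walks_def)
  moreover have "finite (closed_walks l Q)" for l
    using finite_walks[OF assms] by (simp add: closed_walks_def)
  moreover have "inj_on (\<lambda>xs. last xs # xs) A" for A :: "'a list set" by (auto simp: inj_on_def)
  ultimately have "card (walks (Suc (Suc m)) Q) =
      card (closed_walks (Suc (Suc m)) Q) + card (closed_walks (Suc m) Q)"
    by (simp add: card_Un_disjoint card_image)
  then show ?case using card_walks[OF assms, of "Suc m"] Suc by (simp add: algebra_simps)
qed

text \<open>The cyclic indexing matches the rim edges of the wheel.\<close>

lemma closed_walks_conv_nth:
  assumes "n > 0"
  shows "closed_walks n Q =
    {xs. length xs = n \<and> set xs \<subseteq> Q \<and> (\<forall>i<n. xs ! i \<noteq> xs ! ((i + 1) mod n))}"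
proof -
  have "successively (\<noteq>) xs \<and> last xs \<noteq> hd xs \<longleftrightarrow> (\<forall>i<n. xs ! i \<noteq> xs ! ((i + 1) mod n))"
    if "length xs = n" for xs :: "'a list"
  proof -
    have "(\<forall>i<n. xs ! i \<noteq> xs ! ((i + 1) mod n)) \<longleftrightarrow>
        xs ! (n - 1) \<noteq> xs ! 0 \<and> (\<forall>i. Suc i < n \<longrightarrow> xs ! i \<noteq> xs ! Suc i)"
      using assms by (cases n) (auto simp: All_less_Suc)
    moreover have "xs \<noteq> []" using that assms by auto
    ultimately show ?thesis
      using that by (auto simp: successively_conv_nth last_conv_nth hd_conv_nth)
  qed
  then show ?thesis by (auto simp: closed_walks_def walks_def)
qed

section \<open>The wheel and its proper colourings\<close>

lemma verts_wheel: "verts (wheel n) = insert (Inl ()) (Inr ` {..<n})"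
  by (auto simp: wheel_def ugraph_join_def simple_ugraph_def single_vertex_def cycle_graph_def)

lemma card_verts_wheel: "card (verts (wheel n)) = Suc n"
  by (simp add: verts_wheel card_insert_if image_iff card_image)

lemma ends_wheel: "ends (wheel n) e = e"
  by (simp add: wheel_def ugraph_join_def simple_ugraph_def)

lemma edges_wheel:
  "edges (wheel n) =
     (\<lambda>i. {Inr i, Inr ((i + 1) mod n)}) ` {..<n} \<union> (\<lambda>i. {Inl (), Inr i}) ` {..<n}"
proof -
  have "edges (wheel n) =
      (`) Inr ` edges (cycle_graph n) \<union> (\<lambda>i. {Inl (), Inr i}) ` verts (cycle_graph n)"
    unfolding wheel_def ugraph_join_def single_vertex_def simple_ugraph_def
    by (auto simp: cycle_graph_def simple_ugraph_def)
  moreover have "edges (cycle_graph n) = (\<lambda>i. {i, (i + 1) mod n}) ` {..<n}"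
    "verts (cycle_graph n) = {..<n}"
    by (auto simp: cycle_graph_def simple_ugraph_def)
  ultimately show ?thesis by (simp add: image_image)
qed

lemma finite_ugraph_wheel: "finite_ugraph (wheel n)"
proof
  show "\<exists>u\<in>verts (wheel n). \<exists>v\<in>verts (wheel n). ends (wheel n) e = {u, v}"
    if "e \<in> edges (wheel n)" for e
    using that unfolding edges_wheel ends_wheel verts_wheel
    by (elim UnE imageE) (force, blast)
qed (auto simp: verts_wheel edges_wheel)

lemma proper_colourings_wheel:
  "proper_colourings (wheel n) k =
    {f \<in> verts (wheel n) \<rightarrow>\<^sub>E {..<k}. (\<forall>i<n. f (Inl ()) \<noteq> f (Inr i)) \<and>
      (\<forall>i<n. f (Inr i) \<noteq> f (Inr ((i + 1) mod n)))}"
proof -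
  have "monochromatic (wheel n) f {u, v} \<longleftrightarrow> f u = f v" for f :: "unit + nat \<Rightarrow> nat" and u v
    by (rule monochromatic_pair) (simp add: ends_wheel)
  then show ?thesis
    unfolding proper_colourings_def edges_wheel by (auto simp: ball_Un)
qed

text \<open>Once the hub has colour \<open>c\<close>, the rim colours in cyclic order are a closed
  walk on the other \<open>k - 1\<close> colours. This covers \<open>n = 1\<close> as well, where
  the rim edge is a loop and both sides vanish.\<close>

lemma card_proper_colourings_wheel:
  assumes "n > 0" "k > 0"
  shows "int (card (proper_colourings (wheel n) k)) =
    int k * ((int k - 2) ^ n + (-1) ^ n * (int k - 2))"
proof -
  let ?S = "SIGMA c:{..<k}. closed_walks n ({..<k} - {c})"
  have "bij_betw (\<lambda>f. (f (Inl ()), map (\<lambda>i. f (Inr i)) [0..<n])) (proper_colourings (wheel n) k) ?S"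
  proof (rule bij_betw_byWitness[where
        f' = "\<lambda>(c, xs). restrict (case_sum (\<lambda>_. c) (\<lambda>i. xs ! i)) (verts (wheel n))"])
    show "\<forall>f\<in>proper_colourings (wheel n) k.
        (case (f (Inl ()), map (\<lambda>i. f (Inr i)) [0..<n]) of
          (c, xs) \<Rightarrow> restrict (case_sum (\<lambda>_. c) (\<lambda>i. xs ! i)) (verts (wheel n))) = f"
    proof
      fix f assume "f \<in> proper_colourings (wheel n) k"
      then have "f \<in> extensional (verts (wheel n))"
        by (auto simp: proper_colourings_def PiE_def)
      then show "(case (f (Inl ()), map (\<lambda>i. f (Inr i)) [0..<n]) of
          (c, xs) \<Rightarrow> restrict (case_sum (\<lambda>_. c) (\<lambda>i. xs ! i)) (verts (wheel n))) = f"
        by (auto simp: fun_eq_iff verts_wheel extensional_def split: sum.splits)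
    qed
    show "\<forall>p\<in>?S. (\<lambda>f. (f (Inl ()), map (\<lambda>i. f (Inr i)) [0..<n]))
        (case p of (c, xs) \<Rightarrow> restrict (case_sum (\<lambda>_. c) (\<lambda>i. xs ! i)) (verts (wheel n))) = p"
      by (auto simp: closed_walks_conv_nth[OF assms(1)] verts_wheel intro!: nth_equalityI)
    show "(\<lambda>f. (f (Inl ()), map (\<lambda>i. f (Inr i)) [0..<n])) ` proper_colourings (wheel n) k \<subseteq> ?S"
    proof (rule image_subsetI)
      fix f assume "f \<in> proper_colourings (wheel n) k"
      then have f: "\<forall>v\<in>verts (wheel n). f v < k" "\<forall>i<n. f (Inr i) \<noteq> f (Inl ())"
        "\<forall>i<n. f (Inr i) \<noteq> f (Inr ((i + 1) mod n))"
        by (auto simp: proper_colourings_wheel PiE_iff eq_commute)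
      then have "map (\<lambda>i. f (Inr i)) [0..<n] \<in> closed_walks n ({..<k} - {f (Inl ())})"
        unfolding closed_walks_conv_nth[OF assms(1)] using assms(1) by (auto simp: verts_wheel)
      then show "(f (Inl ()), map (\<lambda>i. f (Inr i)) [0..<n]) \<in> ?S"
        using f(1) by (auto simp: verts_wheel)
    qed
    show "(\<lambda>(c, xs). restrict (case_sum (\<lambda>_. c) (\<lambda>i. xs ! i)) (verts (wheel n))) ` ?S \<subseteq>
        proper_colourings (wheel n) k"
      using assms(1)
      by (force simp: closed_walks_conv_nth proper_colourings_wheel verts_wheel PiE_iff
          dest: nth_mem)
  qed
  then have "card (proper_colourings (wheel n) k) =
      (\<Sum>c<k. card (closed_walks n ({..<k} - {c})))"
    by (simp add: bij_betw_same_card closed_walks_def finite_walks)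
  moreover have "int (card (closed_walks n ({..<k} - {c}))) =
      (int k - 2) ^ n + (-1) ^ n * (int k - 2)" if "c < k" for c
    using card_closed_walks[of "{..<k} - {c}" "n - 1"] assms that
    by (simp add: card_Diff_subset of_nat_diff)
  ultimately show ?thesis by simp
qed

text \<open>The difference of the two polynomials has every positive integer as a root. The
  coefficients are indexed from the top degree down, as in Whitney's sum.\<close>

lemma coefficients_eqI:
  fixes a c :: "nat \<Rightarrow> int"
  assumes "\<And>k::nat. k > 0 \<Longrightarrow> (\<Sum>i\<le>n. a i * int k ^ (n - i)) = (\<Sum>i\<le>n. c i * int k ^ (n - i))"
    and "i \<le> n"
  shows "a i = c i"
proof -
  define p where "p f = (\<Sum>i\<le>n. Polynomial.monom (f i) (n - i))" for f :: "nat \<Rightarrow> int"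
  have coeff: "Polynomial.coeff (p f) (n - i) = f i" for f
  proof -
    have "Polynomial.coeff (p f) (n - i) = (\<Sum>j\<le>n. if n - j = n - i then f j else 0)"
      by (simp add: p_def coeff_sum)
    also have "\<dots> = (\<Sum>j\<le>n. if j = i then f j else 0)"
      using assms(2) by (intro sum.cong refl if_cong) auto
    finally show ?thesis using assms(2) by simp
  qed
  have "p a - p c = 0"
  proof (rule ccontr)
    assume "p a - p c \<noteq> 0"
    then have "finite {x. poly (p a - p c) x = 0}" by (rule poly_roots_finite)
    moreover have "int ` {0<..} \<subseteq> {x. poly (p a - p c) x = 0}"
      using assms(1) by (auto simp: p_def poly_sum poly_monom)
    ultimately have "finite (int ` {0<..})" by (rule finite_subset[rotated])
    then show False by (simp add: finite_image_iff infinite_Ioi)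
  qed
  then show ?thesis using coeff[of a] coeff[of c] by simp
qed

text \<open>The two variables allow two uses: \<open>x = -1\<close>, \<open>y = k\<close> yields the
  colouring count, and \<open>y = 1 - x\<close> yields the \<open>h\<close>-polynomial. The binomial
  theorem is corrected only in the terms \<open>n - 1\<close> and \<open>n\<close>.\<close>

lemma binomial_face_sum:
  fixes x y :: "'a::comm_ring_1"
  assumes "n \<ge> 1"
    and b: "\<And>i. i \<le> n \<Longrightarrow> b i = of_nat (n choose i) * 2 ^ i - of_bool (i = n - 1) - 2 * of_bool (i = n)"
  shows "(\<Sum>i\<le>n. b i * x ^ i * y ^ (n - i)) = (2 * x + y) ^ n - x ^ (n - 1) * y - 2 * x ^ n"
proof -
  have "(\<Sum>i\<le>n. b i * x ^ i * y ^ (n - i)) =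
      (\<Sum>i\<le>n. of_nat (n choose i) * (2 * x) ^ i * y ^ (n - i)) -
      (\<Sum>i\<le>n. if i = n - 1 then x ^ i * y ^ (n - i) else 0) -
      (\<Sum>i\<le>n. if i = n then 2 * (x ^ i * y ^ (n - i)) else 0)"
    unfolding sum_subtractf[symmetric]
    by (intro sum.cong refl) (auto simp: b power_mult_distrib algebra_simps)
  then show ?thesis using assms(1) by (simp add: binomial_ring)
qed

text \<open>Over an arbitrary commutative ring this applies both to integer polynomials and to
  rational power series.\<close>

corollary binomial_face_sum_h:
  fixes x :: "'a::comm_ring_1"
  assumes "n \<ge> 1"
    and b: "\<And>i. i \<le> n \<Longrightarrow> b i = of_nat (n choose i) * 2 ^ i - of_bool (i = n - 1) - 2 * of_bool (i = n)"
  shows "(\<Sum>i\<le>n. b i * x ^ i * (1 - x) ^ (n - i)) = (1 + x) ^ n - x ^ (n - 1) - x ^ n"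
proof -
  have "(\<Sum>i\<le>n. b i * x ^ i * (1 - x) ^ (n - i)) =
      (2 * x + (1 - x)) ^ n - x ^ (n - 1) * (1 - x) - 2 * x ^ n"
    by (rule binomial_face_sum[OF assms])
  also have "2 * x + (1 - x) = 1 + x" by simp
  also have "x ^ (n - 1) * (1 - x) = x ^ (n - 1) - x ^ n"
    using power_minus_mult[of n x] assms(1) by (simp add: right_diff_distrib)
  finally show ?thesis by simp
qed

lemma card_bc_complex_wheel:
  assumes "linear_order_on (edges (wheel n)) r" "F \<in> bc_complex (wheel n) r"
  shows "card F \<le> n"
proof -
  have "F \<subseteq> edges (wheel n)" "verts (wheel n) \<noteq> {}"
    using assms(2) by (auto simp: bc_complex_def verts_wheel)
  then show ?thesis
    using finite_ugraph.card_acyclic_less[OF finite_ugraph_wheel _ bc_complex_acyclic[OF assms]]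
    by (simp add: card_verts_wheel less_Suc_eq_le)
qed

lemma sum_bc_complex_wheel:
  fixes f :: "nat \<Rightarrow> 'a::comm_semiring_1"
  assumes "linear_order_on (edges (wheel n)) r"
  shows "(\<Sum>F\<in>bc_complex (wheel n) r. f (card F)) =
    (\<Sum>i\<le>n. of_nat (card {F \<in> bc_complex (wheel n) r. card F = i}) * f i)"
proof -
  have "finite (bc_complex (wheel n) r)"
    using finite_ugraph.finite_edges[OF finite_ugraph_wheel] by (auto simp: bc_complex_def)
  then have "(\<Sum>F\<in>bc_complex (wheel n) r. f (card F)) =
      (\<Sum>i\<le>n. \<Sum>F | F \<in> bc_complex (wheel n) r \<and> card F = i. f (card F))"
    using card_bc_complex_wheel[OF assms] by (intro sum.group[symmetric]) auto
  then show ?thesis by simp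
qed

text \<open>Whitney's sum and the explicit colouring count agree at every positive \<open>k\<close>,
  which determines all coefficients.\<close>

lemma bc_face_numbers_wheel:
  assumes "n \<ge> 1" "linear_order_on (edges (wheel n)) r" "i \<le> n"
  shows "int (card {F \<in> bc_complex (wheel n) r. card F = i}) =
    int (n choose i) * 2 ^ i - of_bool (i = n - 1) - 2 * of_bool (i = n)"
proof -
  interpret finite_ugraph "wheel n" by (rule finite_ugraph_wheel)
  define b where "b i = int (card {F \<in> bc_complex (wheel n) r. card F = i})" for i
  \<comment> \<open>These are the coefficients of \<open>(k - 2) ^ n + (-1) ^ n * (k - 2)\<close> at
    \<open>k ^ (n - i)\<close> with the sign \<open>(-1) ^ i\<close> removed; the linear term
    \<open>k - 2\<close> accounts for the two corrections.\<close>
  define c :: "nat \<Rightarrow> int" where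
    "c i = int (n choose i) * 2 ^ i - of_bool (i = n - 1) - 2 * of_bool (i = n)" for i
  have ne: "verts (wheel n) \<noteq> {}" by (simp add: verts_wheel)
  have "(\<Sum>i\<le>n. (-1) ^ i * b i * int k ^ (n - i)) = (\<Sum>i\<le>n. (-1) ^ i * c i * int k ^ (n - i))"
    if k: "k > 0" for k
  proof -
    \<comment> \<open>The factor \<open>int k\<close> raises the exponents from \<open>n - i\<close>
      to those of Whitney's sum, as the wheel has \<open>n + 1\<close> vertices.\<close>
    have "int k * (\<Sum>i\<le>n. (-1) ^ i * b i * int k ^ (n - i)) =
        (\<Sum>i\<le>n. b i * ((-1) ^ i * int k ^ (Suc n - i)))"
      by (simp add: sum_distrib_left Suc_diff_le mult_ac)
    also have "\<dots> = (\<Sum>F\<in>bc_complex (wheel n) r. (-1) ^ card F * int k ^ (Suc n - card F))"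
      using sum_bc_complex_wheel[OF assms(2), of "\<lambda>i. (-1) ^ i * int k ^ (Suc n - i)"]
      by (simp add: b_def)
    also have "\<dots> = int k * ((int k - 2) ^ n + (-1) ^ n * (int k - 2))"
      using whitney_broken_circuit[OF assms(2) ne k] card_proper_colourings_wheel[of n k] assms(1) k
      by (simp add: card_verts_wheel)
    also have "(int k - 2) ^ n + (-1) ^ n * (int k - 2) =
        (\<Sum>i\<le>n. c i * (-1) ^ i * int k ^ (n - i))"
    proof -
      \<comment> \<open>The correction at \<open>i = n - 1\<close> carries the sign
        \<open>(-1) ^ (n - 1)\<close>, which has to be turned into the \<open>(-1) ^ n\<close> of
        the colouring count.\<close>
      have "(-1) ^ n = - ((-1) ^ (n - 1) :: int)" using assms(1) by (cases n) auto
      then show ?thesis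
        using binomial_face_sum[OF assms(1) c_def, of "-1" "int k"] by (simp add: algebra_simps)
    qed
    finally show ?thesis using k by (simp add: mult_ac)
  qed
  from coefficients_eqI[where a = "\<lambda>i. (-1) ^ i * b i" and c = "\<lambda>i. (-1) ^ i * c i", OF this assms(3)]
  show ?thesis by (simp add: b_def c_def)
qed

lemma of_nat_bc_face_numbers_wheel:
  assumes "n \<ge> 1" "linear_order_on (edges (wheel n)) r" "i \<le> n"
  shows "(of_nat (card {F \<in> bc_complex (wheel n) r. card F = i}) :: 'a::comm_ring_1) =
    of_nat (n choose i) * 2 ^ i - of_bool (i = n - 1) - 2 * of_bool (i = n)"
  using arg_cong[OF bc_face_numbers_wheel[OF assms], of "of_int :: int \<Rightarrow> 'a"]
  by (simp split: if_splits)

lemma sum_bc_face_numbers_wheel: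
  fixes x :: "'a::comm_ring_1"
  assumes "n \<ge> 1" "linear_order_on (edges (wheel n)) r"
  shows "(\<Sum>i\<le>n. of_nat (card {F \<in> bc_complex (wheel n) r. card F = i}) * x ^ i * (1 - x) ^ (n - i)) =
    (1 + x) ^ n - x ^ (n - 1) - x ^ n"
  by (rule binomial_face_sum_h[OF assms(1) of_nat_bc_face_numbers_wheel[OF assms]])

lemma h_polynomial_wheel:
  assumes "n \<ge> 1" "linear_order_on (edges (wheel n)) r"
  shows "h_polynomial (wheel n) r = [:1, 1:] ^ n - [:0, 1:] ^ (n - 1) - [:0, 1:] ^ n"
proof -
  have "[:1, -1:] = 1 - ([:0, 1:] :: int poly)" "[:1, 1:] = 1 + ([:0, 1:] :: int poly)"
    by (auto intro!: poly_eqI simp: coeff_pCons split: nat.split)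
  then show ?thesis
    unfolding h_polynomial_def Let_def card_verts_wheel
    by (simp only: atLeast0AtMost diff_Suc_1 sum_bc_face_numbers_wheel[OF assms])
qed


section \<open>Quotients by squarefree monomial ideals\<close>

text \<open>The coefficient field as a ring record, source of the homomorphism whose image is the
  set of scalars in the quotient.\<close>

definition field_of_type :: "'k::field ring" where
  "field_of_type = \<lparr>carrier = UNIV, mult = (*), one = 1, zero = 0, add = (+)\<rparr>"

lemma field_field_of_type: "field (field_of_type :: 'k::field ring)"
proof -
  have "\<exists>y. x + y = 0" "x \<noteq> 0 \<Longrightarrow> \<exists>y. x * y = 1" for x :: 'k
    by (auto intro: exI[of _ "- x"] exI[of _ "inverse x"])
  then show ?thesis
    unfolding field_of_type_def by unfold_locales (auto simp: algebra_simps Units_def)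
qed


section \<open>The polynomial ring and its monomials\<close>

abbreviation (input) "mkeys \<equiv> Poly_Mapping.keys"
abbreviation (input) "mcoeff \<equiv> Poly_Mapping.lookup"

lemma mvpoly_ring_simps [simp]:
  "p \<in> carrier (mvpoly_ring E) \<longleftrightarrow> (\<forall>m\<in>mkeys p. mkeys m \<subseteq> E)"
  "\<one>\<^bsub>mvpoly_ring E\<^esub> = 1" "\<zero>\<^bsub>mvpoly_ring E\<^esub> = 0"
  "p \<otimes>\<^bsub>mvpoly_ring E\<^esub> q = p * q" "p \<oplus>\<^bsub>mvpoly_ring E\<^esub> q = p + q"
  by (simp_all add: mvpoly_ring_def)

lemma keys_plus_nat:
  fixes a b :: "'a \<Rightarrow>\<^sub>0 nat"
  shows "mkeys (a + b) = mkeys a \<union> mkeys b"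
  by (auto simp: in_keys_iff lookup_add)

lemma cring_mvpoly_ring: "cring (mvpoly_ring E :: ('e, 'k::comm_ring_1) mvpoly ring)"
proof (rule cringI)
  show "abelian_group (mvpoly_ring E :: ('e, 'k) mvpoly ring)"
  proof (rule abelian_groupI)
    show "\<exists>q\<in>carrier (mvpoly_ring E). q \<oplus>\<^bsub>mvpoly_ring E\<^esub> p = \<zero>\<^bsub>mvpoly_ring E\<^esub>"
      if "p \<in> carrier (mvpoly_ring E)" for p :: "('e, 'k) mvpoly"
      using that by (intro bexI[of _ "- p"]) (auto simp: in_keys_iff)
  qed (use keys_add in \<open>fastforce simp: algebra_simps\<close>)+
  show "Group.comm_monoid (mvpoly_ring E :: ('e, 'k) mvpoly ring)"
  proof (rule comm_monoidI)
    show "p \<otimes>\<^bsub>mvpoly_ring E\<^esub> q \<in> carrier (mvpoly_ring E)"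
      if "p \<in> carrier (mvpoly_ring E)" "q \<in> carrier (mvpoly_ring E)" for p q :: "('e, 'k) mvpoly"
    proof -
      have "mkeys m \<subseteq> E" if m: "m \<in> mkeys (p * q)" for m
      proof -
        obtain a b where "m = a + b" "a \<in> mkeys p" "b \<in> mkeys q" using m keys_mult by blast
        then show ?thesis
          using \<open>p \<in> carrier _\<close> \<open>q \<in> carrier _\<close> by (simp add: keys_plus_nat)
      qed
      then show ?thesis by simp
    qed
  qed (simp_all add: algebra_simps)
qed (simp_all add: algebra_simps)

lemma mvpoly_ring_minus:
  assumes "p \<in> carrier (mvpoly_ring E)" "q \<in> carrier (mvpoly_ring E)"
  shows "p \<ominus>\<^bsub>mvpoly_ring E\<^esub> q = p - (q :: ('e, 'k::comm_ring_1) mvpoly)"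
proof -
  interpret cring "mvpoly_ring E :: ('e, 'k) mvpoly ring" by (rule cring_mvpoly_ring)
  have "- q \<in> carrier (mvpoly_ring E)" using assms(2) by (simp add: in_keys_iff)
  then have "\<ominus>\<^bsub>mvpoly_ring E\<^esub> q = - q" using assms(2) by (intro minus_equality) simp_all
  then show ?thesis by (simp add: a_minus_def)
qed

definition restrict_keys :: "'m set \<Rightarrow> ('m \<Rightarrow>\<^sub>0 'k::comm_monoid_add) \<Rightarrow> 'm \<Rightarrow>\<^sub>0 'k" where
  "restrict_keys S p = (\<Sum>m\<in>mkeys p \<inter> S. Poly_Mapping.single m (mcoeff p m))"

lemma lookup_restrict_keys: "mcoeff (restrict_keys S p) m = (if m \<in> S then mcoeff p m else 0)"
proof -
  have "mcoeff (restrict_keys S p) m = (\<Sum>m'\<in>mkeys p \<inter> S. if m' = m then mcoeff p m' else 0)"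
    unfolding restrict_keys_def lookup_sum
    by (intro sum.cong) (auto simp: lookup_single when_def)
  then show ?thesis by (auto simp: in_keys_iff)
qed

lemma keys_restrict_keys: "mkeys (restrict_keys S p) = mkeys p \<inter> S"
  by (auto simp: in_keys_iff lookup_restrict_keys split: if_splits)

lemma restrict_keys_UNIV: "restrict_keys UNIV p = p"
  by (rule poly_mapping_eqI) (simp add: lookup_restrict_keys)

definition squarefree_monom :: "'e set \<Rightarrow> ('e \<Rightarrow>\<^sub>0 nat)" where
  "squarefree_monom B = (\<Sum>e\<in>B. Poly_Mapping.single e 1)"

lemma lookup_squarefree_monom:
  assumes "finite B"
  shows "mcoeff (squarefree_monom B) e = of_bool (e \<in> B)"
  using assms by (simp add: squarefree_monom_def lookup_sum lookup_single when_def)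

lemma keys_squarefree_monom: "finite B \<Longrightarrow> mkeys (squarefree_monom B) = B"
  by (auto simp: in_keys_iff lookup_squarefree_monom)

lemma prod_mvar:
  assumes "finite B"
  shows "(\<Prod>e\<in>B. mvar e) = (Poly_Mapping.single (squarefree_monom B) 1 :: ('e, 'k::comm_ring_1) mvpoly)"
  using assms
proof (induction B)
  case empty
  then show ?case by (simp add: squarefree_monom_def)
next
  case (insert e B)
  then show ?case by (simp add: squarefree_monom_def mvar_def mult_single)
qed

text \<open>Divisibility by a squarefree monomial is containment of supports, so membership can be
  tested on each term separately.\<close>

definition monomial_ideal :: "'e set \<Rightarrow> 'e set set \<Rightarrow> ('e, 'k::comm_ring_1) mvpoly set" where
  "monomial_ideal E \<B> =
     {p \<in> carrier (mvpoly_ring E). \<forall>m\<in>mkeys p. \<exists>B\<in>\<B>. B \<subseteq> mkeys m}"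

lemma ideal_monomial_ideal:
  "ideal (monomial_ideal E \<B>) (mvpoly_ring E :: ('e, 'k::comm_ring_1) mvpoly ring)"
proof -
  interpret cring "mvpoly_ring E :: ('e, 'k) mvpoly ring" by (rule cring_mvpoly_ring)
  have mult: "x * a \<in> monomial_ideal E \<B>"
    if a: "a \<in> monomial_ideal E \<B>" and x: "x \<in> carrier (mvpoly_ring E)" for a x :: "('e, 'k) mvpoly"
  proof -
    have "\<exists>B\<in>\<B>. B \<subseteq> mkeys m" if "m \<in> mkeys (x * a)" for m
    proof -
      obtain b c where "m = b + c" "c \<in> mkeys a" using \<open>m \<in> _\<close> keys_mult by blast
      moreover obtain B where "B \<in> \<B>" "B \<subseteq> mkeys c"
        using a \<open>c \<in> mkeys a\<close> by (auto simp: monomial_ideal_def)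
      ultimately show ?thesis by (auto simp: keys_plus_nat)
    qed
    moreover have "x * a \<in> carrier (mvpoly_ring E)"
      using m_closed[OF x, of a] a by (simp add: monomial_ideal_def)
    ultimately show ?thesis by (simp add: monomial_ideal_def)
  qed
  show ?thesis
  proof (rule idealI)
    show "ring (mvpoly_ring E :: ('e, 'k) mvpoly ring)" by (rule ring_axioms)
    show "subgroup (monomial_ideal E \<B>) (add_monoid (mvpoly_ring E :: ('e, 'k) mvpoly ring))"
    proof (rule add.subgroupI)
      show "monomial_ideal E \<B> \<subseteq> carrier (mvpoly_ring E :: ('e, 'k) mvpoly ring)"
        by (auto simp: monomial_ideal_def)
      have "(0 :: ('e, 'k) mvpoly) \<in> monomial_ideal E \<B>" by (simp add: monomial_ideal_def)
      then show "monomial_ideal E \<B> \<noteq> ({} :: ('e, 'k) mvpoly set)" by blast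
      show "\<ominus>\<^bsub>mvpoly_ring E\<^esub> a \<in> monomial_ideal E \<B>"
        if "a \<in> monomial_ideal E \<B>" for a :: "('e, 'k) mvpoly"
      proof -
        have "a \<in> carrier (mvpoly_ring E)" using that by (simp add: monomial_ideal_def)
        then have "\<ominus>\<^bsub>mvpoly_ring E\<^esub> a = - a"
          using mvpoly_ring_minus[of 0 E a] by (simp add: a_minus_def)
        then show ?thesis using that by (simp add: monomial_ideal_def in_keys_iff)
      qed
      show "a \<oplus>\<^bsub>mvpoly_ring E\<^esub> b \<in> monomial_ideal E \<B>"
        if "a \<in> monomial_ideal E \<B>" "b \<in> monomial_ideal E \<B>" for a b :: "('e, 'k) mvpoly"
      proof -
        have "\<exists>B\<in>\<B>. B \<subseteq> mkeys m" if "m \<in> mkeys (a + b)" for m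
        proof -
          have "m \<in> mkeys a \<or> m \<in> mkeys b" using that keys_add[of a b] by auto
          then show ?thesis
            using \<open>a \<in> monomial_ideal E \<B>\<close> \<open>b \<in> monomial_ideal E \<B>\<close>
            by (auto simp only: monomial_ideal_def mem_Collect_eq)
        qed
        moreover have "a \<oplus>\<^bsub>mvpoly_ring E\<^esub> b \<in> carrier (mvpoly_ring E)"
          using that by (intro a_closed) (auto simp only: monomial_ideal_def)
        ultimately show ?thesis by (simp add: monomial_ideal_def)
      qed
    qed
    show "x \<otimes>\<^bsub>mvpoly_ring E\<^esub> a \<in> monomial_ideal E \<B>"
      "a \<otimes>\<^bsub>mvpoly_ring E\<^esub> x \<in> monomial_ideal E \<B>"
      if "a \<in> monomial_ideal E \<B>" "x \<in> carrier (mvpoly_ring E)" for a x :: "('e, 'k) mvpoly"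
      using mult[OF that] by (simp_all add: mult.commute)
  qed
qed

text \<open>The generators lie in the monomial ideal; conversely, each term of a member is a
  multiple of a generator, and the member is the sum of its terms.\<close>

lemma genideal_squarefree:
  assumes "finite E" "\<And>B. B \<in> \<B> \<Longrightarrow> B \<subseteq> E"
  shows "Idl\<^bsub>mvpoly_ring E\<^esub> {\<Prod>e\<in>B. mvar e | B. B \<in> \<B>} =
    (monomial_ideal E \<B> :: ('e, 'k::comm_ring_1) mvpoly set)" (is "Idl\<^bsub>_\<^esub> ?S = _")
proof
  interpret cring "mvpoly_ring E :: ('e, 'k) mvpoly ring" by (rule cring_mvpoly_ring)
  have finB: "finite B" if "B \<in> \<B>" for B using assms that finite_subset by metis
  have gen: "(\<Prod>e\<in>B. mvar e :: ('e, 'k) mvpoly) \<in> monomial_ideal E \<B>" if "B \<in> \<B>" for B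
    using that assms(2)[OF that]
    by (auto simp: monomial_ideal_def prod_mvar finB keys_squarefree_monom)
  then show "Idl\<^bsub>mvpoly_ring E\<^esub> ?S \<subseteq> monomial_ideal E \<B>"
    by (intro genideal_minimal ideal_monomial_ideal) blast
  have S: "?S \<subseteq> carrier (mvpoly_ring E)" using gen by (force simp: monomial_ideal_def)
  interpret I: ideal "Idl\<^bsub>mvpoly_ring E\<^esub> ?S" "mvpoly_ring E" by (rule genideal_ideal[OF S])
  show "monomial_ideal E \<B> \<subseteq> Idl\<^bsub>mvpoly_ring E\<^esub> ?S"
  proof
    fix p :: "('e, 'k) mvpoly" assume p: "p \<in> monomial_ideal E \<B>"
    have summand: "Poly_Mapping.single m (mcoeff p m) \<in> Idl\<^bsub>mvpoly_ring E\<^esub> ?S" if m: "m \<in> mkeys p" for m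
    proof -
      obtain B where B: "B \<in> \<B>" "B \<subseteq> mkeys m" using p m by (auto simp: monomial_ideal_def)
      \<comment> \<open>All exponents of \<open>m\<close> on \<open>B\<close> are at least one, so
        this truncated subtraction is exact and \<open>m'\<close> is the cofactor.\<close>
      define m' where "m' = m - squarefree_monom B"
      have "mkeys m \<subseteq> E" using p m by (auto simp: monomial_ideal_def)
      moreover have mm: "m = m' + squarefree_monom B"
        using B(2) finB[OF B(1)]
        by (intro poly_mapping_eqI)
          (auto simp: m'_def lookup_add lookup_minus lookup_squarefree_monom in_keys_iff)
      ultimately have "mkeys m' \<subseteq> E" by (simp add: keys_plus_nat)
      then have "Poly_Mapping.single m' (mcoeff p m) \<otimes>\<^bsub>mvpoly_ring E\<^esub> (\<Prod>e\<in>B. mvar e)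
          \<in> Idl\<^bsub>mvpoly_ring E\<^esub> ?S"
        using genideal_self[OF S] B(1) by (intro I.I_l_closed) auto
      then show ?thesis using mm by (simp add: prod_mvar[OF finB[OF B(1)]] mult_single)
    qed
    have "(\<Sum>m\<in>A. Poly_Mapping.single m (mcoeff p m)) \<in> Idl\<^bsub>mvpoly_ring E\<^esub> ?S"
      if "finite A" "A \<subseteq> mkeys p" for A
      using that
    proof (induction A rule: finite_induct)
      case empty
      then show ?case using I.zero_closed by simp
    next
      case (insert m A)
      then show ?case using I.a_closed[OF summand[of m]] by simp
    qed
    from this[of "mkeys p"] show "p \<in> Idl\<^bsub>mvpoly_ring E\<^esub> ?S"
      using restrict_keys_UNIV[of p] by (simp add: restrict_keys_def)
  qed
qed

section \<open>Standard monomials as a basis of the quotient\<close>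

definition standard_monoms :: "'e set \<Rightarrow> 'e set set \<Rightarrow> ('e \<Rightarrow>\<^sub>0 nat) set" where
  "standard_monoms E \<B> = {m. mkeys m \<subseteq> E \<and> (\<forall>B\<in>\<B>. \<not> B \<subseteq> mkeys m)}"

context
  fixes E :: "'e set" and \<B> :: "'e set set"
    and R :: "('e, 'k::field) mvpoly ring" and J Q K
  defines "R \<equiv> mvpoly_ring E" and "J \<equiv> monomial_ideal E \<B>" and "Q \<equiv> R Quot J"
    and "K \<equiv> {J +>\<^bsub>R\<^esub> mconst c | c. True}"
  assumes proper: "{} \<notin> \<B>"
begin

interpretation R: cring R unfolding R_def by (rule cring_mvpoly_ring)
interpretation J: ideal J R unfolding R_def J_def by (rule ideal_monomial_ideal)
interpretation Q: ring Q unfolding Q_def by (rule J.quotient_is_ring)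

lemma coset_eq_iff:
  assumes "p \<in> carrier R" "q \<in> carrier R"
  shows "J +>\<^bsub>R\<^esub> p = J +>\<^bsub>R\<^esub> q \<longleftrightarrow> p - q \<in> J"
  using R.quotient_eq_iff_same_a_r_cos[OF J.ideal_axioms assms] mvpoly_ring_minus[of p E q] assms
  by (simp add: R_def)

text \<open>The image of a field in a nonzero ring is a field. Dimensions over it are therefore
  unique, as the \<open>THE\<close> in the Hilbert series requires.\<close>

lemma subfield_scalars: "subfield K Q"
proof -
  let ?k = "field_of_type :: 'k ring"
  interpret k: field ?k by (rule field_field_of_type)
  have carr: "mconst c \<in> carrier R" for c by (auto simp: mconst_def R_def)
  have hom: "ring_hom_ring ?k Q (\<lambda>c. J +>\<^bsub>R\<^esub> mconst c)"
  proof (rule ring_hom_ringI)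
    fix a b :: 'k
    have "mconst (a * b) = mconst a \<otimes>\<^bsub>R\<^esub> mconst b" "mconst (a + b) = mconst a \<oplus>\<^bsub>R\<^esub> mconst b"
      by (simp_all add: R_def mconst_def mult_single single_add)
    then show "J +>\<^bsub>R\<^esub> mconst (a \<otimes>\<^bsub>?k\<^esub> b) = (J +>\<^bsub>R\<^esub> mconst a) \<otimes>\<^bsub>Q\<^esub> (J +>\<^bsub>R\<^esub> mconst b)"
      "J +>\<^bsub>R\<^esub> mconst (a \<oplus>\<^bsub>?k\<^esub> b) = (J +>\<^bsub>R\<^esub> mconst a) \<oplus>\<^bsub>Q\<^esub> (J +>\<^bsub>R\<^esub> mconst b)"
      using J.rcoset_mult_add[OF carr carr] J.a_rcos_sum[OF carr carr]
      by (simp_all add: field_of_type_def Q_def FactRing_def)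
  next
    show "J +>\<^bsub>R\<^esub> mconst \<one>\<^bsub>?k\<^esub> = \<one>\<^bsub>Q\<^esub>"
      by (simp add: field_of_type_def Q_def FactRing_def mconst_def R_def)
  next
    show "J +>\<^bsub>R\<^esub> mconst a \<in> carrier Q" for a
      using ring_hom_memE(1)[OF J.rcos_ring_hom carr] by (simp add: Q_def)
  qed (rule k.ring_axioms Q.ring_axioms)+
  \<comment> \<open>The empty set would contribute the generator 1 and collapse the
    quotient.\<close>
  have "1 \<notin> J" using proper by (auto simp: J_def monomial_ideal_def)
  then have "\<one>\<^bsub>Q\<^esub> \<noteq> \<zero>\<^bsub>Q\<^esub>"
    using J.a_rcos_self[OF R.one_closed] by (auto simp: Q_def FactRing_def R_def)
  then have "subfield ((\<lambda>c. J +>\<^bsub>R\<^esub> mconst c) ` carrier ?k) Q"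
    using ring_hom_ring.img_is_subfield(2)[OF hom k.carrier_is_subfield] by simp
  moreover have "(\<lambda>c. J +>\<^bsub>R\<^esub> mconst c) ` carrier ?k = K"
    by (auto simp: K_def field_of_type_def)
  ultimately show ?thesis by simp
qed

text \<open>Each further monomial enlarges the span by a line: it cannot be congruent to a
  combination of the earlier ones, since every term of a member of \<open>J\<close> is
  nonstandard.\<close>

lemma dimension_standard_monoms:
  assumes "finite M" "M \<subseteq> standard_monoms E \<B>"
  shows "ring.dimension Q (card M) K {J +>\<^bsub>R\<^esub> p | p. p \<in> carrier R \<and> mkeys p \<subseteq> M}"
  using assms
proof (induction M)
  case empty
  have "{J +>\<^bsub>R\<^esub> p | p. p \<in> carrier R \<and> mkeys p \<subseteq> {}} = {\<zero>\<^bsub>Q\<^esub>}"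
    using J.a_rcos_const[OF J.zero_closed] by (auto simp: Q_def FactRing_def R_def)
  then show ?case using Q.zero_dim by simp
next
  case (insert m M)
  define V where "V M = {J +>\<^bsub>R\<^esub> p | p. p \<in> carrier R \<and> mkeys p \<subseteq> M}" for M
  define x where "x c = (Poly_Mapping.single m c :: ('e, 'k) mvpoly)" for c
  have m: "mkeys m \<subseteq> E" "\<And>B. B \<in> \<B> \<Longrightarrow> \<not> B \<subseteq> mkeys m"
    using insert.prems by (auto simp: standard_monoms_def)
  have x: "x c \<in> carrier R" for c using m(1) by (auto simp: x_def R_def)
  have const: "mconst c \<in> carrier R" for c by (auto simp: mconst_def R_def)
  have lin: "(J +>\<^bsub>R\<^esub> mconst c) \<otimes>\<^bsub>Q\<^esub> (J +>\<^bsub>R\<^esub> x 1) \<oplus>\<^bsub>Q\<^esub> (J +>\<^bsub>R\<^esub> p) = J +>\<^bsub>R\<^esub> (x c + p)"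
    if "p \<in> carrier R" for c p
  proof -
    have "mconst c \<otimes>\<^bsub>R\<^esub> x 1 = x c" by (simp add: R_def mconst_def x_def mult_single)
    then show ?thesis
      using J.rcoset_mult_add[OF const x, of c 1] J.a_rcos_sum[OF x that]
      by (simp add: Q_def FactRing_def) (simp add: R_def)
  qed
  have "V (insert m M) = Q.line_extension K (J +>\<^bsub>R\<^esub> x 1) (V M)"
  proof (intro equalityI subsetI)
    fix u assume "u \<in> V (insert m M)"
    then obtain p where p: "u = J +>\<^bsub>R\<^esub> p" "p \<in> carrier R" "mkeys p \<subseteq> insert m M"
      by (auto simp: V_def)
    define q where "q = restrict_keys M p"
    have "q \<in> carrier R" using p(2) by (auto simp: q_def R_def keys_restrict_keys)
    moreover have "p = x (mcoeff p m) + q"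
      using p(3) insert.hyps(2)
      by (intro poly_mapping_eqI)
        (auto simp: x_def q_def lookup_add lookup_restrict_keys lookup_single when_def in_keys_iff)
    moreover have "mkeys q \<subseteq> M" by (simp add: q_def keys_restrict_keys)
    ultimately show "u \<in> Q.line_extension K (J +>\<^bsub>R\<^esub> x 1) (V M)"
      unfolding Q.line_extension_mem_iff using lin[of q "mcoeff p m"] p(1)
      by (auto simp: V_def K_def)
  next
    fix u assume "u \<in> Q.line_extension K (J +>\<^bsub>R\<^esub> x 1) (V M)"
    then obtain c p where "p \<in> carrier R" "mkeys p \<subseteq> M" "u = J +>\<^bsub>R\<^esub> (x c + p)"
      unfolding Q.line_extension_mem_iff using lin by (auto simp: V_def K_def)
    moreover have "x c + p \<in> carrier R" using R.a_closed[OF x] \<open>p \<in> carrier R\<close> by (simp add: R_def)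
    moreover have "mkeys (x c + p) \<subseteq> insert m M"
      using keys_add[of "x c" p] \<open>mkeys p \<subseteq> M\<close> by (auto simp: x_def split: if_splits)
    ultimately show "u \<in> V (insert m M)" by (auto simp: V_def)
  qed
  moreover have "J +>\<^bsub>R\<^esub> x 1 \<notin> V M"
  proof
    assume "J +>\<^bsub>R\<^esub> x 1 \<in> V M"
    then obtain p where p: "p \<in> carrier R" "mkeys p \<subseteq> M" "x 1 - p \<in> J"
      using coset_eq_iff[OF x] by (auto simp: V_def)
    \<comment> \<open>As \<open>m\<close> is not in \<open>M\<close>, the polynomial
      \<open>p\<close> has no such term to cancel the one of \<open>x 1\<close>.\<close>
    then have "mcoeff (x 1 - p) m = 1"
      using insert.hyps(2) by (auto simp: lookup_minus x_def in_keys_iff)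
    then have "m \<in> mkeys (x 1 - p)" by (simp add: in_keys_iff)
    then show False using p(3) m(2) by (auto simp: J_def monomial_ideal_def)
  qed
  moreover have "J +>\<^bsub>R\<^esub> x 1 \<in> carrier Q"
    using ring_hom_memE(1)[OF J.rcos_ring_hom x] by (simp add: Q_def)
  moreover have "Q.dimension (card M) K (V M)" using insert by (simp add: V_def)
  ultimately show ?case
    using Q.Suc_dim insert.hyps by (simp add: V_def)
qed

lemma dimension_component:
  assumes "finite {m \<in> standard_monoms E \<B>. mdeg m = d}"
  shows "(THE n. ring.dimension Q n K
      {J +>\<^bsub>R\<^esub> p | p. p \<in> carrier R \<and> (\<forall>m\<in>mkeys p. mdeg m = d)}) =
    card {m \<in> standard_monoms E \<B>. mdeg m = d}"
proof -
  let ?M = "{m \<in> standard_monoms E \<B>. mdeg m = d}"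
  have "{J +>\<^bsub>R\<^esub> p | p. p \<in> carrier R \<and> (\<forall>m\<in>mkeys p. mdeg m = d)} =
      {J +>\<^bsub>R\<^esub> p | p. p \<in> carrier R \<and> mkeys p \<subseteq> ?M}" (is "?L = ?V")
  proof (intro equalityI subsetI)
    fix u assume "u \<in> ?L"
    then obtain p where p: "u = J +>\<^bsub>R\<^esub> p" "p \<in> carrier R" "\<forall>m\<in>mkeys p. mdeg m = d" by blast
    define q where "q = restrict_keys ?M p"
    have q: "q \<in> carrier R" "mkeys q \<subseteq> ?M"
      using p(2) by (auto simp: q_def R_def keys_restrict_keys)
    have "\<exists>B\<in>\<B>. B \<subseteq> mkeys m" if "m \<in> mkeys (p - q)" for m
    proof -
      have "m \<in> mkeys p" "m \<notin> ?M"
        using that by (auto simp: q_def in_keys_iff lookup_minus lookup_restrict_keys split: if_splits)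
      then show ?thesis using p by (auto simp: standard_monoms_def R_def)
    qed
    moreover have "mkeys (p - q) \<subseteq> mkeys p"
      by (auto simp: q_def in_keys_iff lookup_minus lookup_restrict_keys split: if_splits)
    ultimately have "p - q \<in> J" using p(2) by (auto simp: J_def monomial_ideal_def R_def)
    then show "u \<in> ?V" using coset_eq_iff[OF p(2) q(1)] p(1) q by blast
  qed auto
  moreover have "Q.dimension (card ?M) K ?V" using assms by (intro dimension_standard_monoms) auto
  ultimately show ?thesis
    using Q.dimension_is_inj[OF subfield_scalars] by (intro the_equality) auto
qed

end


section \<open>Counting standard monomials\<close>

lemma mdeg_eq:
  assumes "finite S" "mkeys m \<subseteq> S"
  shows "mdeg m = (\<Sum>e\<in>S. mcoeff m e)"
  unfolding mdeg_def by (rule sum.mono_neutral_left) (use assms in \<open>auto simp: in_keys_iff\<close>)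

lemma mdeg_plus: "mdeg (a + b) = mdeg a + mdeg b"
  by (simp add: mdeg_eq[of "mkeys a \<union> mkeys b"] keys_plus_nat lookup_add sum.distrib)

lemma mdeg_single: "mdeg (Poly_Mapping.single e a) = a"
  by (simp add: mdeg_def)

definition monoms_support :: "'e set \<Rightarrow> nat \<Rightarrow> ('e \<Rightarrow>\<^sub>0 nat) set" where
  "monoms_support F d = {m. mkeys m = F \<and> mdeg m = d}"

text \<open>A monomial splits into its power of \<open>e\<close> and the rest; the exponent is at
  least one because \<open>e\<close> is in the support.\<close>

lemma monoms_support_insert:
  assumes "e \<notin> F"
  shows "bij_betw (\<lambda>(a, m). Poly_Mapping.single e a + m)
    (SIGMA a:{1..d}. monoms_support F (d - a)) (monoms_support (insert e F) d)"
proof (rule bij_betw_byWitness[where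
      f' = "\<lambda>m. (mcoeff m e, m - Poly_Mapping.single e (mcoeff m e))"])
  have e: "mcoeff m e = 0" if "m \<in> monoms_support F d'" for m d'
    using that assms by (auto simp: monoms_support_def in_keys_iff)
  show "\<forall>p\<in>SIGMA a:{1..d}. monoms_support F (d - a).
      (\<lambda>m. (mcoeff m e, m - Poly_Mapping.single e (mcoeff m e)))
        ((\<lambda>(a, m). Poly_Mapping.single e a + m) p) = p"
    by (auto simp: lookup_add e)
  have split: "Poly_Mapping.single e (mcoeff m e) + (m - Poly_Mapping.single e (mcoeff m e)) = m"
    for m :: "'a \<Rightarrow>\<^sub>0 nat"
    by (rule poly_mapping_eqI) (auto simp: lookup_add lookup_minus lookup_single when_def)
  then show "\<forall>m\<in>monoms_support (insert e F) d. (\<lambda>(a, m). Poly_Mapping.single e a + m)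
      (mcoeff m e, m - Poly_Mapping.single e (mcoeff m e)) = m"
    by simp
  show "(\<lambda>(a, m). Poly_Mapping.single e a + m) ` (SIGMA a:{1..d}. monoms_support F (d - a)) \<subseteq>
      monoms_support (insert e F) d"
    by (auto simp: monoms_support_def keys_plus_nat mdeg_plus mdeg_single)
  show "(\<lambda>m. (mcoeff m e, m - Poly_Mapping.single e (mcoeff m e))) ` monoms_support (insert e F) d \<subseteq>
      (SIGMA a:{1..d}. monoms_support F (d - a))"
  proof (rule image_subsetI)
    fix m assume m: "m \<in> monoms_support (insert e F) d"
    define m' where "m' = m - Poly_Mapping.single e (mcoeff m e)"
    have "mcoeff m e + mdeg m' = d"
      using m split[of m] mdeg_plus[of "Poly_Mapping.single e (mcoeff m e)" m']
      by (simp add: m'_def mdeg_single monoms_support_def)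
    moreover have "e \<in> mkeys m" using m by (simp add: monoms_support_def)
    then have "mcoeff m e \<ge> 1" by (simp add: in_keys_iff)
    moreover have "mkeys m' = mkeys m - {e}"
      by (auto simp: m'_def in_keys_iff lookup_minus lookup_single when_def split: if_splits)
    then have "mkeys m' = F" using m assms by (auto simp: monoms_support_def)
    ultimately show "(mcoeff m e, m - Poly_Mapping.single e (mcoeff m e))
        \<in> (SIGMA a:{1..d}. monoms_support F (d - a))"
      by (auto simp: monoms_support_def m'_def)
  qed
qed

text \<open>This series counts the choices of a single positive exponent.\<close>

lemma fps_geometric_nth:
  "fps_nth (fps_X * inverse (1 - fps_X :: rat fps)) i = of_bool (i \<ge> 1)"
proof -
  have "inverse (1 - fps_X :: rat fps) = Abs_fps (\<lambda>_. 1)"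
    using fps_inverse_gp'[where 'a = rat] by (metis fps_inverse_idempotent fps_nth_Abs_fps one_neq_zero)
  then show ?thesis by simp
qed

text \<open>The exponents on \<open>F\<close> are chosen independently and are all positive, so each
  edge contributes one factor to the generating function.\<close>

lemma card_monoms_support:
  fixes F :: "'e set"
  assumes "finite F"
  shows "finite (monoms_support F d) \<and>
    of_nat (card (monoms_support F d)) = fps_nth ((fps_X * inverse (1 - fps_X :: rat fps)) ^ card F) d"
  using assms
proof (induction F arbitrary: d rule: finite_induct)
  case empty
  have "monoms_support ({} :: 'e set) d = (if d = 0 then {0} else {})"
    by (auto simp: monoms_support_def mdeg_def)
  then show ?case by (cases "d = 0") auto
next
  case (insert e F)
  let ?g = "fps_X * inverse (1 - fps_X :: rat fps)"
  let ?S = "SIGMA a:{1..d}. monoms_support F (d - a)"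
  have bij: "bij_betw (\<lambda>(a, m). Poly_Mapping.single e a + m) ?S (monoms_support (insert e F) d)"
    by (rule monoms_support_insert[OF insert.hyps(2)])
  have "finite ?S" using insert.IH by blast
  then have "finite (monoms_support (insert e F) d)" using bij_betw_finite[OF bij] by simp
  moreover have "of_nat (card (monoms_support (insert e F) d)) = fps_nth (?g ^ card (insert e F)) d"
  proof -
    have "card (monoms_support (insert e F) d) = (\<Sum>a\<in>{1..d}. card (monoms_support F (d - a)))"
      using insert.IH by (simp flip: bij_betw_same_card[OF bij])
    then have "rat_of_nat (card (monoms_support (insert e F) d)) =
        (\<Sum>a\<in>{1..d}. fps_nth (?g ^ card F) (d - a))"
      using insert.IH by simp
    \<comment> \<open>A zero term for \<open>a = 0\<close> turns the sum into a Cauchy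
      product.\<close>
    also have "\<dots> = (\<Sum>a=0..d. of_bool (a \<ge> 1) * fps_nth (?g ^ card F) (d - a))"
      by (rule sum.mono_neutral_cong_left) auto
    also have "\<dots> = fps_nth (?g * ?g ^ card F) d"
      by (simp only: fps_mult_nth[of ?g] fps_geometric_nth)
    finally show ?thesis using insert.hyps by simp
  qed
  ultimately show ?case by blast
qed

text \<open>The standard monomials are partitioned by their supports, which are exactly the subsets
  of \<open>E\<close> containing no member of \<open>\<B>\<close>.\<close>

lemma standard_monoms_of_degree:
  assumes "finite E"
  shows "finite {m \<in> standard_monoms E \<B>. mdeg m = d}"
    and "of_nat (card {m \<in> standard_monoms E \<B>. mdeg m = d}) =
      fps_nth (\<Sum>F | F \<subseteq> E \<and> (\<forall>B\<in>\<B>. \<not> B \<subseteq> F). (fps_X * inverse (1 - fps_X :: rat fps)) ^ card F) d"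
proof -
  let ?\<F> = "{F. F \<subseteq> E \<and> (\<forall>B\<in>\<B>. \<not> B \<subseteq> F)}"
  have eq: "{m \<in> standard_monoms E \<B>. mdeg m = d} = (\<Union>F\<in>?\<F>. monoms_support F d)"
    by (auto simp: standard_monoms_def monoms_support_def)
  have fin: "finite ?\<F>" using assms by simp
  have finF: "finite F" if "F \<in> ?\<F>" for F using that assms finite_subset by blast
  show "finite {m \<in> standard_monoms E \<B>. mdeg m = d}"
    unfolding eq using fin finF card_monoms_support by (intro finite_UN_I) auto
  have "card (\<Union>F\<in>?\<F>. monoms_support F d) = (\<Sum>F\<in>?\<F>. card (monoms_support F d))"
    using fin finF card_monoms_support
    by (intro card_UN_disjoint) (auto simp: monoms_support_def)
  also have "rat_of_nat \<dots> = (\<Sum>F\<in>?\<F>. fps_nth ((fps_X * inverse (1 - fps_X)) ^ card F) d)"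
    unfolding of_nat_sum using finF card_monoms_support by (intro sum.cong) auto
  finally show "of_nat (card {m \<in> standard_monoms E \<B>. mdeg m = d}) =
      fps_nth (\<Sum>F\<in>?\<F>. (fps_X * inverse (1 - fps_X :: rat fps)) ^ card F) d"
    unfolding eq fps_sum_nth .
qed

section \<open>The Hilbert series of the broken-circuit ring\<close>

context finite_ugraph begin

lemma bc_hilbert_series_eq:
  assumes "{} \<notin> broken_circuits G r"
  shows "bc_hilbert_series TYPE('k::field) G r =
    (\<Sum>F\<in>bc_complex G r. (fps_X * inverse (1 - fps_X)) ^ card F)"
proof (rule fps_ext)
  fix d
  let ?\<B> = "broken_circuits G r"
  have sub: "B \<subseteq> edges G" if "B \<in> ?\<B>" for B
    using that is_cycleD(1) by (auto simp: broken_circuits_def)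
  have I: "bc_ideal G r = (monomial_ideal (edges G) ?\<B> :: ('e, 'k) mvpoly set)"
    unfolding bc_ideal_def by (rule genideal_squarefree[OF finite_edges sub])
  have "fps_nth (bc_hilbert_series TYPE('k) G r) d =
      of_nat (card {m \<in> standard_monoms (edges G) ?\<B>. mdeg m = d})"
    unfolding bc_hilbert_series_def hilbert_series_def bc_component_def bc_scalars_def bc_ring_def I
    unfolding fps_nth_Abs_fps dimension_component[OF assms standard_monoms_of_degree(1)[OF finite_edges]]
    ..
  also have "\<dots> = fps_nth (\<Sum>F\<in>bc_complex G r. (fps_X * inverse (1 - fps_X)) ^ card F) d"
    unfolding standard_monoms_of_degree(2)[OF finite_edges] bc_complex_def ..
  finally show "fps_nth (bc_hilbert_series TYPE('k) G r) d = \<dots>" .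
qed

end

text \<open>An empty broken circuit comes from a cycle with one edge, which is a loop and has a
  single endpoint.\<close>

lemma empty_not_broken_circuit:
  assumes "\<And>e. e \<in> edges G \<Longrightarrow> card (ends G e) = 2"
  shows "{} \<notin> broken_circuits G r"
proof
  assume "{} \<in> broken_circuits G r"
  then obtain C m where "is_cycle G C" "m \<in> C" "C - {m} = {}"
    by (auto simp: broken_circuits_def)
  moreover from this have "C = {m}" by blast
  ultimately have "is_cycle G {m}" by simp
  then obtain vs es where c: "length vs = length es" "distinct es" "set es \<subseteq> edges G"
    "\<And>i. i < length es \<Longrightarrow> ends G (es ! i) = {vs ! i, vs ! ((i + 1) mod length vs)}" "set es = {m}"
    unfolding is_cycle_def by (elim exE conjE) simp
  have "length es = 1" using distinct_card[OF c(2)] c(5) by simp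
  then have "ends G (es ! 0) = {vs ! 0}" "es ! 0 \<in> edges G"
    using c(4)[of 0] c(1,3) nth_mem[of 0 es] by auto
  then show False using assms[of "es ! 0"] by simp
qed

lemma card_ends_wheel:
  assumes "n \<ge> 2" "e \<in> edges (wheel n)"
  shows "card (ends (wheel n) e) = 2"
proof -
  have "i \<noteq> Suc i mod n" if "i < n" for i
    using that assms(1) by (cases "i + 1 = n") auto
  then show ?thesis using assms(2) by (auto simp: edges_wheel ends_wheel card_insert_if)
qed

text \<open>Multiplication by \<open>(1 - fps_X) ^ n\<close> turns the contribution of a face of
  size \<open>i\<close> into \<open>fps_X ^ i * (1 - fps_X) ^ (n - i)\<close>, the summand of the
  \<open>h\<close>-polynomial; the factor is nonzero and can be divided out again.\<close>

lemma bc_hilbert_series_wheel: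
  assumes "n \<ge> 2" "linear_order_on (edges (wheel n)) r"
  shows "bc_hilbert_series TYPE('k::field) (wheel n) r =
    ((1 + fps_X) ^ n - fps_X ^ (n - 1) - fps_X ^ n) / (1 - fps_X) ^ n"
proof -
  let ?Y = "1 - fps_X :: rat fps"
  let ?g = "fps_X * inverse ?Y"
  let ?H = "bc_hilbert_series TYPE('k) (wheel n) r"
  have Y: "?g * ?Y = fps_X" by (simp add: mult.assoc inverse_mult_eq_1)
  have "?H = (\<Sum>F\<in>bc_complex (wheel n) r. ?g ^ card F)"
    using assms(1) card_ends_wheel
    by (intro finite_ugraph.bc_hilbert_series_eq finite_ugraph_wheel empty_not_broken_circuit) auto
  also have "\<dots> = (\<Sum>i\<le>n. of_nat (card {F \<in> bc_complex (wheel n) r. card F = i}) * ?g ^ i)"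
    by (rule sum_bc_complex_wheel[OF assms(2)])
  finally have "?H * ?Y ^ n =
      (\<Sum>i\<le>n. of_nat (card {F \<in> bc_complex (wheel n) r. card F = i}) * (?g ^ i * ?Y ^ n))"
    by (simp add: sum_distrib_right mult.assoc)
  also have "\<dots> =
      (\<Sum>i\<le>n. of_nat (card {F \<in> bc_complex (wheel n) r. card F = i}) * fps_X ^ i * ?Y ^ (n - i))"
  proof (rule sum.cong)
    fix i assume "i \<in> {..n}"
    then have "?Y ^ n = ?Y ^ i * ?Y ^ (n - i)" by (simp flip: power_add)
    then have "?g ^ i * ?Y ^ n = (?g * ?Y) ^ i * ?Y ^ (n - i)"
      by (simp only: power_mult_distrib mult_ac)
    then show "of_nat (card {F \<in> bc_complex (wheel n) r. card F = i}) * (?g ^ i * ?Y ^ n) =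
        of_nat (card {F \<in> bc_complex (wheel n) r. card F = i}) * fps_X ^ i * ?Y ^ (n - i)"
      unfolding Y by (simp only: mult.assoc)
  qed simp
  also have "\<dots> = (1 + fps_X) ^ n - fps_X ^ (n - 1) - fps_X ^ n"
    using assms by (intro sum_bc_face_numbers_wheel) simp_all
  finally have "?H * ?Y ^ n = (1 + fps_X) ^ n - fps_X ^ (n - 1) - fps_X ^ n" .
  moreover have "?Y ^ n \<noteq> 0" by simp
  ultimately show ?thesis by (metis nonzero_mult_div_cancel_right)
qed

theorem theorem6p2:
  fixes n :: nat and r :: "(unit + nat) set rel"
  assumes "n \<ge> 3" and "linear_order_on (edges (wheel n)) r"
  shows "h_polynomial (wheel n) r = [:1, 1:] ^ n - [:0, 1:] ^ (n - 1) - [:0, 1:] ^ n \<and>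
    bc_hilbert_series TYPE('k::field) (wheel n) r =
      ((1 + fps_X) ^ n - fps_X ^ (n - 1) - fps_X ^ n) / (1 - fps_X) ^ n"
  using assms by (intro conjI h_polynomial_wheel bc_hilbert_series_wheel) simp_all

end
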